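(* Consider colored positive integers as follows. There are four primary colors $A,B,C,D$, six secondary colors $AB,AC,AD,BC,BD,CD$, and one quaternary color $ABCD$ (no ternary colors are used). Every integer $n\ge 1$ occurs in each of the four primary colors; every integer $n\ge 2$ occurs in each of the six secondary colors; every integer $n\ge 4$ occurs in the quaternary color. Write $X_n$ for the integer $n$ in color $X$; its value (size) is $n$. Colored integers are totally ordered by: if $m<n$ as ordinary integers then $m$ in any color is less than $n$ in any color, and for equal integers in different colors the order is $$ABCD<AB<AC<AD<A<BC<BD<B<CD<C<D.$$ (We say one color is of higher order than another if it comes later in this list.) Let $i,j,k,l$ be nonnegative integers. Let $P(n;i,j,k,l)$ denote the number of partitions of $n$ into parts in the four primary colors only, parts of the same color being distinct, with exactly $i$ parts of color $A$, $j$ of color $B$, $k$ of color $C$, and $l$ of color $D$. For nonnegative integers $n_A,n_B,n_C,n_D,n_{AB},n_{AC},n_{AD},n_{BC},n_{BD},n_{CD},Q$, let $G(n;n_A,\dots,n_{CD},Q)$ denote the number of partitions of $n$ into colored parts (from the eleven colors above) having exactly $n_X$ parts of color $X$ for each primary or secondary color $X$ and exactly $Q$ parts of color $ABCD$, such that: (i) for any two consecutive non-quaternary parts (consecutive in the order above among the parts not of color $ABCD$), the difference of their integer values is $\ge 1$, with equality only if either both parts are of the same primary color, or the larger part is in a color of higher order than the color of the smaller part; (ii) the difference of integer values between any two consecutive quaternary parts is $\ge 4$; (iii) the smallest quaternary part (if any) has integer value $\ge 3+2\tau$ if $A_1$ is a part, and $\ge 4+2\tau$ otherwise, where $\tau=n_A+n_B+n_C+n_D+n_{AB}+n_{AC}+n_{AD}+n_{BC}+n_{BD}+n_{CD}$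 is the number of non-quaternary parts. Then for all $n$, $$P(n;i,j,k,l)=\sum G(n;n_A,n_B,n_C,n_D,n_{AB},n_{AC},n_{AD},n_{BC},n_{BD},n_{CD},Q),$$ where the sum is over all nonnegative integers $n_A,\dots,n_{CD},Q$ satisfying $$i=n_A+n_{AB}+n_{AC}+n_{AD}+Q,\quad j=n_B+n_{AB}+n_{BC}+n_{BD}+Q,$$ $$k=n_C+n_{AC}+n_{BC}+n_{CD}+Q,\quad l=n_D+n_{AD}+n_{BD}+n_{CD}+Q.$$ *)

theory Defs
  imports Main "HOL-Library.Multiset" "HOL-Library.Product_Lexorder"
begin

datatype color = A | B | C | D | AB | AC | AD | BC | BD | CD | ABCD

fun rank :: "color \<Rightarrow> nat" where
  "rank ABCD = 0" | "rank AB = 1" | "rank AC = 2" | "rank AD = 3" | "rank A = 4"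
| "rank BC = 5" | "rank BD = 6" | "rank B = 7" | "rank CD = 8" | "rank C = 9" | "rank D = 10"

definition primary :: "color \<Rightarrow> bool" where
  "primary c \<longleftrightarrow> c \<in> {A, B, C, D}"

definition secondary :: "color \<Rightarrow> bool" where
  "secondary c \<longleftrightarrow> c \<in> {AB, AC, AD, BC, BD, CD}"

definition quaternary :: "color \<Rightarrow> bool" where
  "quaternary c \<longleftrightarrow> c = ABCD"

definition minval :: "color \<Rightarrow> nat" where
  "minval c = (if primary c then 1 else if secondary c then 2 else 4)"

type_synonym part = "nat \<times> color"

definition valid_part :: "part \<Rightarrow> bool" where
  "valid_part p \<longleftrightarrow> fst p \<ge> minval (snd p)"

definition pkey :: "part \<Rightarrow> nat \<times> nat" where
  "pkey p = (fst p, rank (snd p))"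

definition P_count :: "nat \<Rightarrow> nat \<Rightarrow> nat \<Rightarrow> nat \<Rightarrow> nat \<Rightarrow> nat" where
  "P_count n i j k l = card {M :: part multiset.
      (\<forall>p \<in># M. primary (snd p) \<and> valid_part p)
    \<and> (\<forall>p. count M p \<le> 1)
    \<and> sum_mset (image_mset fst M) = n
    \<and> size (filter_mset (\<lambda>p. snd p = A) M) = i
    \<and> size (filter_mset (\<lambda>p. snd p = B) M) = j
    \<and> size (filter_mset (\<lambda>p. snd p = C) M) = k
    \<and> size (filter_mset (\<lambda>p. snd p = D) M) = l}"

definition cond_i :: "part multiset \<Rightarrow> bool" where
  "cond_i M \<longleftrightarrow> (\<forall>xs. mset xs = filter_mset (\<lambda>p. \<not> quaternary (snd p)) M
      \<and> sorted (map pkey xs) \<longrightarrow>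
      (\<forall>t. Suc t < length xs \<longrightarrow>
         fst (xs ! Suc t) \<ge> fst (xs ! t) + 1
       \<and> (fst (xs ! Suc t) = fst (xs ! t) + 1 \<longrightarrow>
            (snd (xs ! t) = snd (xs ! Suc t) \<and> primary (snd (xs ! t)))
          \<or> rank (snd (xs ! t)) < rank (snd (xs ! Suc t)))))"

definition cond_ii :: "part multiset \<Rightarrow> bool" where
  "cond_ii M \<longleftrightarrow> (\<forall>xs. mset xs = filter_mset (\<lambda>p. quaternary (snd p)) M
      \<and> sorted (map pkey xs) \<longrightarrow>
      (\<forall>t. Suc t < length xs \<longrightarrow> fst (xs ! Suc t) \<ge> fst (xs ! t) + 4))"

text \<open>Condition (iii): bound on the smallest quaternary part (equivalently on every one).\<close>
definition cond_iii :: "part multiset \<Rightarrow> bool" where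
  "cond_iii M \<longleftrightarrow> (let \<tau> = size (filter_mset (\<lambda>p. \<not> quaternary (snd p)) M) in
      \<forall>q \<in># M. quaternary (snd q) \<longrightarrow>
        fst q \<ge> (if (1, A) \<in># M then 3 else 4) + 2 * \<tau>)"

text \<open>G(n; counts): counts given as a function c :: color => nat
  (c X = n_X for primary/secondary X, c ABCD = Q).\<close>
definition G_count :: "nat \<Rightarrow> (color \<Rightarrow> nat) \<Rightarrow> nat" where
  "G_count n c = card {M :: part multiset.
      (\<forall>p \<in># M. valid_part p)
    \<and> sum_mset (image_mset fst M) = n
    \<and> (\<forall>X. size (filter_mset (\<lambda>p. snd p = X) M) = c X)
    \<and> cond_i M \<and> cond_ii M \<and> cond_iii M}"

end

theory Submission
  imports Defs "HOL-Computational_Algebra.Formal_Power_Series"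
    "HOL-Library.Poly_Mapping" "HOL-Library.Product_Plus"
begin

text \<open>
  Subtract the staircase 1, 2, 3, ... from the non-quaternary parts (so that a weak chain of colored
  integers remains) and the progression 3 + 2\<open>\<tau>\<close>, 7 + 2\<open>\<tau>\<close>, ... from the quaternary
  ones. What is subtracted amounts to \<open>m (m + 1) / 2\<close>, where \<open>m\<close> counts the
  non-quaternary parts once and the quaternary parts twice. Hence, if \<open>z\<close> marks \<open>m\<close> and
  \<open>a, b, c, d\<close> mark the primary colors, the generating function of the right-hand side is the
  image of an explicit product \<open>H(z; a, b, c, d)\<close>, a polynomial times a quotient of infinite
  products, under the linear map \<open>S\<close> sending \<open>z^m\<close> to \<open>q^(m (m + 1) / 2)\<close>.
  This map satisfies \<open>S (z f(z)) = q S (f(q z))\<close>, and a single polynomial identity shows that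
  \<open>S H(a) - (1 + a q) S H(a q)\<close> is \<open>a\<close> times \<open>S (z f(z)) - q S (f(q z))\<close> for a
  suitable \<open>f\<close>, hence zero. As \<open>H\<close> is symmetric in \<open>a, b, c, d\<close>, iteration gives
  \<open>S H = (-a q)\<^sub>\<infinity> (-b q)\<^sub>\<infinity> (-c q)\<^sub>\<infinity> (-d q)\<^sub>\<infinity>\<close>, the generating function of
  the left-hand side.
\<close>

section \<open>The q-series identity\<close>

text \<open>
  In \<^typ>\<open>'a fps fps\<close> the inner variable is \<open>q\<close> and the outer one is \<open>z\<close>; thus
  \<open>qshift\<close> replaces \<open>z\<close> by \<open>q z\<close>.
\<close>

unbundle fps_syntax

text \<open>Cancellation works over any commutative ring, because a series with constant term 1 is a
  unit; no division of coefficients occurs.\<close>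

lemma fps_left_cancel_unit:
  fixes p g h :: "'a::comm_ring_1 fps"
  assumes "p $ 0 = 1" "p * g = p * h"
  shows "g = h"
proof -
  have "p * fps_right_inverse p 1 = 1"
    using assms(1) by (intro fps_right_inverse) simp
  then show ?thesis
    using assms(2) by (metis mult.commute mult.left_commute mult.right_neutral)
qed

text \<open>This is 1 / (q; q)_n with q = \<open>fps_X\<close>, formed by
  \<open>fps_right_inverse\<close> because the coefficients are only a commutative ring.\<close>

primrec inv_qpoch :: "nat \<Rightarrow> 'a::comm_ring_1 fps" where
  "inv_qpoch 0 = 1"
| "inv_qpoch (Suc n) = inv_qpoch n * fps_right_inverse (1 - fps_X ^ Suc n) 1"

lemma inv_qpoch_Suc: "inv_qpoch (Suc n) - fps_X ^ Suc n * inv_qpoch (Suc n) = inv_qpoch n"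
proof -
  have "(1 - fps_X ^ Suc n :: 'a fps) * fps_right_inverse (1 - fps_X ^ Suc n) 1 = 1"
    by (rule fps_right_inverse) simp
  then have "inv_qpoch (Suc n) * (1 - fps_X ^ Suc n :: 'a fps) = inv_qpoch n"
    by (simp only: inv_qpoch.simps mult.assoc) (simp add: mult.commute)
  then show ?thesis
    by (simp only: right_diff_distrib mult_1_right mult.commute[of "fps_X ^ Suc n"])
qed

section \<open>Functional equations under z -> q z and the q-Pochhammer series\<close>

definition qshift :: "'a::comm_ring_1 fps fps \<Rightarrow> 'a fps fps" where
  "qshift f = Abs_fps (\<lambda>m. fps_X ^ m * f $ m)"

lemma qshift_nth [simp]: "qshift f $ m = fps_X ^ m * f $ m"
  by (simp add: qshift_def)

lemma qshift_mult: "qshift (f * g) = qshift f * qshift g"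
proof (rule fps_ext)
  fix m
  have "fps_X ^ m * (f $ i * g $ (m - i)) = fps_X ^ i * f $ i * (fps_X ^ (m - i) * g $ (m - i))"
    if "i \<le> m" for i
  proof -
    have "fps_X ^ m = (fps_X ^ i * fps_X ^ (m - i) :: 'a fps)"
      using that by (metis le_add_diff_inverse power_add)
    then show ?thesis by (simp only: mult.assoc mult.left_commute)
  qed
  then show "qshift (f * g) $ m = (qshift f * qshift g) $ m"
    by (simp add: fps_mult_nth sum_distrib_left)
qed

abbreviation cc :: "'a::comm_ring_1 fps \<Rightarrow> 'a fps fps" where
  "cc \<equiv> fps_const"

text \<open>Once the lower coefficients of the difference h vanish, the coefficient of z^m in its
  equation reads h_m = q^m h_m, and 1 - q^m is a unit for m > 0. Such an equation therefore
  determines a series from its constant term.\<close>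

lemma qshift_unique:
  fixes f g p r :: "'a::comm_ring_1 fps fps"
  assumes "p * f = r * qshift f" "p * g = r * qshift g"
    and "p $ 0 = 1" "r $ 0 = 1" "f $ 0 = g $ 0"
  shows "f = g"
proof -
  define h where "h = f - g"
  have "qshift h = qshift f - qshift g"
    by (rule fps_ext) (simp add: h_def algebra_simps)
  then have h: "p * h = r * qshift h"
    using assms(1,2) by (simp only: h_def right_diff_distrib)
  have "h $ m = 0" for m
  proof (induction m rule: less_induct)
    case (less m)
    show ?case
    proof (cases "m = 0")
      case False
      have eq: "(s * t) $ m = t $ m"
        if "s $ 0 = 1" "\<And>i. i < m \<Longrightarrow> t $ i = 0" for s t :: "'a fps fps"
      proof -
        have "(s * t) $ m = (\<Sum>i=0..m. s $ i * t $ (m - i))" by (rule fps_mult_nth)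
        also have "\<dots> = (\<Sum>i=0..m. if i = 0 then t $ m else 0)"
          using that False by (intro sum.cong) auto
        finally show ?thesis by simp
      qed
      have "h $ m = fps_X ^ m * h $ m"
        using eq[of p h] eq[of r "qshift h"] assms(3,4) less h by simp
      then have *: "(1 - fps_X ^ m) * h $ m = (1 - fps_X ^ m) * 0"
        by (simp add: algebra_simps)
      show ?thesis by (rule fps_left_cancel_unit[OF _ *]) (use False in simp)
    qed (use assms(5) in \<open>simp add: h_def\<close>)
  qed
  then show ?thesis by (simp add: h_def fps_eq_iff)
qed

text \<open>
  \<open>recip_poch a\<close>, \<open>recip_poch_sq a\<close> and \<open>poch a\<close> are the expansions of
  \<open>1 / (a z; q)\<^sub>\<infinity>\<close>, \<open>1 / (a z^2; q)\<^sub>\<infinity>\<close> and \<open>(-a z; q)\<^sub>\<infinity>\<close>.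
\<close>

definition recip_poch :: "'a::comm_ring_1 fps \<Rightarrow> 'a fps fps" where
  "recip_poch a = Abs_fps (\<lambda>m. a ^ m * inv_qpoch m)"

definition recip_poch_sq :: "'a::comm_ring_1 fps \<Rightarrow> 'a fps fps" where
  "recip_poch_sq a = Abs_fps (\<lambda>m. if even m then recip_poch a $ (m div 2) else 0)"

definition poch :: "'a::comm_ring_1 fps \<Rightarrow> 'a fps fps" where
  "poch a = Abs_fps (\<lambda>m. a ^ m * fps_X ^ (m choose 2) * inv_qpoch m)"

lemma fps_one_plus_const_X_mult_nth:
  "((1 + cc a * fps_X) * f) $ m = f $ m + (if m = 0 then 0 else a * f $ (m - 1))"
  by (cases m) (simp_all add: algebra_simps)

lemma fps_one_minus_const_X_mult_nth:
  "((1 - cc a * fps_X) * f) $ m = f $ m - (if m = 0 then 0 else a * f $ (m - 1))"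
  by (cases m) (simp_all add: algebra_simps)

lemma fps_one_minus_const_X2_mult_nth:
  "((1 - cc a * fps_X ^ 2) * f) $ m = f $ m - (if m < 2 then 0 else a * f $ (m - 2))"
  by (simp add: left_diff_distrib mult.assoc fps_X_power_mult_nth)

lemma recip_poch_nth_0 [simp]: "recip_poch a $ 0 = 1" and poch_nth_0 [simp]: "poch a $ 0 = 1"
  and recip_poch_sq_nth_0 [simp]: "recip_poch_sq a $ 0 = 1"
  by (simp_all add: recip_poch_def poch_def recip_poch_sq_def binomial_eq_0)

lemma recip_poch_shift: "recip_poch (fps_X * a) = qshift (recip_poch a)"
  and poch_shift: "poch (fps_X * a) = qshift (poch a)"
  by (rule fps_ext, simp add: recip_poch_def poch_def power_mult_distrib mult.assoc)+

text \<open>Coefficientwise this is the recurrence \<open>inv_qpoch_Suc\<close>. Together with the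
  constant term it characterizes the infinite product, which is never formed as a limit.\<close>

lemma recip_poch_rec: "(1 - cc a * fps_X) * recip_poch a = qshift (recip_poch a)"
proof (rule fps_ext)
  fix m
  show "((1 - cc a * fps_X) * recip_poch a) $ m = qshift (recip_poch a) $ m"
  proof (cases m)
    case (Suc k)
    define u where "u = (inv_qpoch (Suc k) :: 'a fps)"
    have eq: "inv_qpoch k = u - fps_X ^ Suc k * u"
      unfolding u_def by (rule inv_qpoch_Suc[symmetric])
    show ?thesis
      unfolding fps_one_minus_const_X_mult_nth Suc
      by (simp add: recip_poch_def u_def[symmetric] eq algebra_simps del: inv_qpoch.simps)
  qed (simp add: recip_poch_def)
qed

lemma recip_poch_sq_shift: "recip_poch_sq (fps_X * a) = (1 - cc a * fps_X ^ 2) * recip_poch_sq a"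
proof (rule fps_ext)
  fix m
  have eq: "recip_poch (fps_X * a) $ k = ((1 - cc a * fps_X) * recip_poch a) $ k" for k
    by (simp only: recip_poch_shift recip_poch_rec)
  show "recip_poch_sq (fps_X * a) $ m = ((1 - cc a * fps_X ^ 2) * recip_poch_sq a) $ m"
  proof (cases "even m")
    case True
    then obtain k where k: "m = 2 * k" by (rule evenE)
    show ?thesis
      unfolding fps_one_minus_const_X2_mult_nth k
      by (cases k) (simp_all add: recip_poch_sq_def eq fps_one_minus_const_X_mult_nth)
  next
    case False
    then show ?thesis
      unfolding fps_one_minus_const_X2_mult_nth by (auto simp: recip_poch_sq_def)
  qed
qed

text \<open>The variable enters as z^2, so z -> q z multiplies the parameter by q^2 and takes off
  two factors of the product instead of one.\<close>

lemma qshift_recip_poch_sq: "qshift (recip_poch_sq a) = recip_poch_sq (fps_X * (fps_X * a))"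
proof (rule fps_ext)
  fix m
  show "qshift (recip_poch_sq a) $ m = recip_poch_sq (fps_X * (fps_X * a)) $ m"
    by (cases "even m") (auto simp: recip_poch_sq_def recip_poch_def power_mult_distrib power_add
        mult_2 mult.assoc elim!: evenE)
qed

lemma Suc_choose_2: "Suc m choose 2 = m + (m choose 2)"
  by (simp add: numeral_2_eq_2)

lemma poch_rec: "poch a = (1 + cc a * fps_X) * qshift (poch a)"
proof (rule fps_ext)
  fix m
  show "poch a $ m = ((1 + cc a * fps_X) * qshift (poch a)) $ m"
  proof (cases m)
    case (Suc k)
    define u where "u = (inv_qpoch (Suc k) :: 'a fps)"
    have eq: "inv_qpoch k = u - fps_X ^ Suc k * u"
      unfolding u_def by (rule inv_qpoch_Suc[symmetric])
    show ?thesis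
      unfolding fps_one_plus_const_X_mult_nth Suc
      by (simp add: poch_def u_def[symmetric] eq Suc_choose_2 algebra_simps power_add del:
          inv_qpoch.simps)
  qed (simp add: poch_def)
qed

text \<open>
  The map sending \<open>z^m\<close> to \<open>q^(m (m + 1) / 2)\<close>; truncating at \<open>m \<le> n\<close> is harmless
  because \<open>m (m + 1) / 2 \<ge> m\<close>.
\<close>

definition stair_sum :: "'a::comm_ring_1 fps fps \<Rightarrow> 'a fps" where
  "stair_sum f = Abs_fps (\<lambda>n. (\<Sum>m\<le>n. fps_X ^ (Suc m choose 2) * f $ m) $ n)"

text \<open>The truncation in \<open>stair_sum\<close> moves with the index of the coefficient.
  Allowing any larger bound lets several coefficients be read from one finite sum.\<close>

lemma stair_sum_nth:
  assumes "n \<le> k"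
  shows "stair_sum f $ n = (\<Sum>m\<le>k. fps_X ^ (Suc m choose 2) * f $ m) $ n"
proof -
  have "(\<Sum>m\<le>k. (fps_X ^ (Suc m choose 2) * f $ m) $ n)
      = (\<Sum>m\<le>n. (fps_X ^ (Suc m choose 2) * f $ m) $ n)"
    using assms by (intro sum.mono_neutral_right) (auto simp: fps_X_power_mult_nth Suc_choose_2)
  then show ?thesis by (simp add: stair_sum_def fps_sum_nth)
qed

lemma stair_sum_add: "stair_sum (f + g) = stair_sum f + stair_sum g"
  by (rule fps_ext) (simp add: stair_sum_def algebra_simps sum.distrib)

lemma stair_sum_const_mult: "stair_sum (cc c * f) = c * stair_sum f"
proof (rule fps_ext)
  fix n
  define T where "T = (\<Sum>m\<le>n. fps_X ^ (Suc m choose 2) * f $ m)"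
  have "stair_sum (cc c * f) $ n = (c * T) $ n"
    by (simp add: stair_sum_def T_def sum_distrib_left mult.left_commute)
  also have "\<dots> = (c * stair_sum f) $ n"
    using stair_sum_nth[of _ n f] by (auto simp: fps_mult_nth T_def intro!: sum.cong)
  finally show "stair_sum (cc c * f) $ n = (c * stair_sum f) $ n" .
qed

lemma stair_sum_diff: "stair_sum (f - g) = stair_sum f - stair_sum g"
  using stair_sum_add[of "f - g" g] by (simp add: algebra_simps)

text \<open>Raising m by one raises m (m + 1) / 2 by m + 1: the 1 gives the outer factor q, the m
  gives \<open>qshift\<close>.\<close>

lemma stair_sum_X_mult: "stair_sum (fps_X * f) = fps_X * stair_sum (qshift f)"
proof (rule fps_ext)
  fix n
  have "stair_sum (fps_X * f) $ n = (\<Sum>m\<le>Suc n. fps_X ^ (Suc m choose 2) * (fps_X * f) $ m) $ n"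
    by (rule stair_sum_nth) simp
  also have "\<dots> = (\<Sum>m\<le>n. fps_X ^ (Suc (Suc m) choose 2) * f $ m) $ n"
    by (subst sum.atMost_Suc_shift) simp
  also have "\<dots> = (fps_X * (\<Sum>m\<le>n. fps_X ^ (Suc m choose 2) * qshift f $ m)) $ n"
    by (simp add: sum_distrib_left Suc_choose_2 power_add mult.assoc mult.left_commute)
  \<comment> \<open>The factor q lowers the index to n - 1, for which the sum up to n is still an
    admissible truncation.\<close>
  also have "\<dots> = (fps_X * stair_sum (qshift f)) $ n"
    using stair_sum_nth[of "n - 1" n "qshift f"] by simp
  finally show "stair_sum (fps_X * f) $ n = (fps_X * stair_sum (qshift f)) $ n" .
qed


section \<open>The configuration series and its functional equation\<close>

text \<open>In elementary symmetric polynomials: 1 + (e_3 - e_4) z^2 + (e_1 e_4 - e_4) z^3 + e_4^2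
  z^5. It records how a configuration may begin; see \<open>boundary_identity\<close>.\<close>

definition boundary_poly :: "'a::comm_ring_1 fps \<Rightarrow> 'a fps \<Rightarrow> 'a fps \<Rightarrow> 'a fps \<Rightarrow> 'a fps fps" where
  "boundary_poly a b c d = 1 + (cc a * cc b * cc c + cc a * cc b * cc d + cc a * cc c * cc d
      + cc b * cc c * cc d
        - cc a * cc b * cc c * cc d) * fps_X ^ 2
     + (cc a * cc b * cc c * cc d * (cc a + cc b + cc c + cc d) - cc a * cc b * cc c * cc d)
         * fps_X ^ 3
     + (cc a * cc b * cc c * cc d) ^ 2 * fps_X ^ 5"

text \<open>Primary colors give reciprocal products because their entries may repeat in a chain,
  secondary colors give products, and the quaternary color gives a reciprocal product in z^2 because
  its entries count twice.\<close>

definition config_series :: "'a::comm_ring_1 fps \<Rightarrow> 'a fps \<Rightarrow> 'a fps \<Rightarrow> 'a fps \<Rightarrow> 'a fps fps" where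
  "config_series a b c d = boundary_poly a b c d *
      (recip_poch a * recip_poch b * recip_poch c * recip_poch d)
     * (poch (fps_X * (a * b)) * poch (fps_X * (a * c)) * poch (fps_X * (a * d))
        * (poch (fps_X * (b * c)) * poch (fps_X * (b * d)) * poch (fps_X * (c * d))))
     * recip_poch_sq (a * b * c * d)"

text \<open>
  The two products on the right are the ratios of \<open>f(z)\<close> and \<open>f(q z)\<close> to the common factor
  of \<open>H(a)\<close> and \<open>H(a q)\<close>, so that \<open>stair_sum\<close> annihilates the right-hand side.
\<close>

lemma certificate:
  fixes a b c d q z :: "'a::comm_ring_1"
  defines "x \<equiv> a*b*c*d"
  shows "(1 + (a*b*c+a*b*d+a*c*d+b*c*d - x)*z^2 + (x*(a+b+c+d) - x)*z^3 + x^2*z^5)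
            * ((1+q*(a*b)*z)*(1+q*(a*c)*z)*(1+q*(a*d)*z))
         - (1+a*q) * ((1 + (q*a*b*c+q*a*b*d+q*a*c*d+b*c*d - q*x)*z^2 + (q*x*(q*a+b+c+d) - q*x)*z^3
             + (q*x)^2*z^5)
            * ((1-a*z)*(1-x*z^2)))
       = a * (z * ((1+q*(a*b)*z)*(1+q*(a*c)*z)*(1+q*(a*d)*z)*(1+b*c*z)*(1+b*d*z)*(1+c*d*z))
            - q * ((1-a*z)*(1-b*z)*(1-c*z)*(1-d*z)*((1-x*z^2)*(1-q*x*z^2))))"
  unfolding x_def by (simp add: algebra_simps eval_nat_numeral)

text \<open>Both occurrences of \<open>config_series\<close> are polynomial multiples of one series
  \<open>K\<close>. The difference of the multipliers is evaluated by \<open>certificate\<close>,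
  and what results is annihilated through \<open>stair_sum_X_mult\<close>.\<close>

lemma stair_sum_config_series_rec: "stair_sum (config_series a b c d)
    = (1 + a * fps_X) * stair_sum (config_series (fps_X * a) b c d)"
proof -
  define q x where "q = (fps_X :: 'a fps)" and "x = a * b * c * d"
  define Z where "Z = (fps_X :: 'a fps fps)"
  define Es where "Es = recip_poch a * recip_poch b * recip_poch c * recip_poch d"
  \<comment> \<open>The products involving a are taken with a q in place of a, the reciprocals in
    \<open>K\<close> with a itself; this leaves only polynomial quotients on both sides.\<close>
  define Ns where "Ns = poch (q * (q * (a * b))) * poch (q * (q * (a * c))) * poch
      (q * (q * (a * d)))
        * (poch (q * (b * c)) * poch (q * (b * d)) * poch (q * (c * d)))"
  define K where "K = Es * Ns * recip_poch_sq x"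
  define D1 where "D1 = (1 + cc q * (cc a * cc b) * Z) * (1 + cc q * (cc a * cc c) * Z) *
      (1 + cc q * (cc a * cc d) * Z)"
  define D2 where "D2 = (1 + cc b * cc c * Z) * (1 + cc b * cc d * Z) * (1 + cc c * cc d * Z)"
  define F where "F = (1 - cc a * Z) * (1 - cc b * Z) * (1 - cc c * Z) * (1 - cc d * Z)
     * ((1 - cc x * Z ^ 2) * (1 - cc q * cc x * Z ^ 2))"
  have poch_step: "poch y = (1 + cc y * Z) * poch (q * y)" for y
    unfolding Z_def q_def poch_shift by (rule poch_rec)
  have HK: "config_series a b c d = boundary_poly a b c d * D1 * K"
    unfolding config_series_def K_def Es_def D1_def Ns_def x_def q_def[symmetric]
    unfolding poch_step[of "q * (a * b)"] poch_step[of "q * (a * c)"] poch_step[of "q * (a * d)"]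
    by (simp only: fps_const_mult[symmetric] mult_ac)
  have Eq: "recip_poch (q * a) = (1 - cc a * Z) * recip_poch a" for a
    unfolding Z_def q_def recip_poch_shift by (rule recip_poch_rec[symmetric])
  have E2q: "recip_poch_sq (q * a) = (1 - cc a * Z ^ 2) * recip_poch_sq a" for a
    unfolding Z_def q_def by (rule recip_poch_sq_shift)
  have HqK: "config_series (q * a) b c d = boundary_poly (q * a) b c d *
      ((1 - cc a * Z) * (1 - cc x * Z ^ 2)) * K"
  proof -
    have *: "q * a * b * c * d = q * x" "q * (q * a * y) = q * (q * (a * y))" for y
      by (simp_all add: x_def mult.assoc)
    show ?thesis
      unfolding config_series_def K_def Es_def Ns_def q_def[symmetric] * Eq[of a] E2q
      by (simp only: mult_ac)
  qed
  \<comment> \<open>The series f of the telescoping. The products without a start one factor earlier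
    than in \<open>config_series\<close>, so that \<open>qshift G\<close> contains exactly the
    products in \<open>Ns\<close>.\<close>
  define G where "G = Es * (poch (q * (a * b)) * poch (q * (a * c)) * poch (q * (a * d))
        * (poch (b * c) * poch (b * d) * poch (c * d))) * recip_poch_sq x"
  have G1: "G = D1 * D2 * K"
    unfolding G_def K_def Es_def D1_def D2_def Ns_def
    unfolding poch_step[of "q * (a * b)"] poch_step[of "q * (a * c)"] poch_step[of "q * (a * d)"]
        poch_step[of "b * c"] poch_step[of "b * d"] poch_step[of "c * d"]
    by (simp only: fps_const_mult[symmetric] mult_ac)
  have G2: "qshift G = F * K"
    unfolding G_def K_def Es_def F_def Ns_def
    unfolding qshift_mult qshift_recip_poch_sq poch_shift[symmetric] recip_poch_shift[symmetric]
        q_def[symmetric]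
      Eq E2q fps_const_mult[symmetric]
    by (simp only: mult_ac)
  have cert: "boundary_poly a b c d * D1 - (1 + cc (a * q)) *
      (boundary_poly (q * a) b c d * ((1 - cc a * Z) * (1 - cc x * Z ^ 2)))
     = cc a * (Z * (D1 * D2) - cc q * F)"
    using certificate[of "cc a" "cc b" "cc c" "cc d" Z "cc q"]
    unfolding boundary_poly_def D1_def D2_def F_def x_def Z_def[symmetric] fps_const_mult[symmetric]
    by (simp only: mult.assoc)
  have "stair_sum (config_series a b c d) - (1 + a * q) * stair_sum (config_series (q * a) b c d)
      = stair_sum (config_series a b c d - (1 + cc (a * q)) * config_series (q * a) b c d)"
    by (simp add: stair_sum_diff stair_sum_add stair_sum_const_mult distrib_right)
  also have "config_series a b c d - (1 + cc (a * q)) * config_series (q * a) b c d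
      = (boundary_poly a b c d * D1 - (1 + cc (a * q)) *
          (boundary_poly (q * a) b c d * ((1 - cc a * Z) * (1 - cc x * Z ^ 2)))) * K"
    unfolding HK HqK by (simp only: left_diff_distrib[of _ _ K] mult.assoc)
  also have "\<dots> = cc a * (Z * G - cc q * qshift G)"
    unfolding cert G2 unfolding G1 by (simp only: left_diff_distrib mult.assoc)
  also have "stair_sum \<dots> = a * (stair_sum (Z * G) - q * stair_sum (qshift G))"
    by (simp only: stair_sum_const_mult stair_sum_diff)
  also have "\<dots> = 0"
    by (simp add: Z_def q_def stair_sum_X_mult)
  finally show ?thesis by (simp add: q_def)
qed

lemma boundary_poly_commute: "boundary_poly a b c d
    = boundary_poly b a c d" "boundary_poly a b c d
        = boundary_poly c b a d" "boundary_poly a b c d = boundary_poly d b c a"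
  by (simp_all add: boundary_poly_def algebra_simps)

lemma config_series_commute: "config_series a b c d
    = config_series b a c d" "config_series a b c d
        = config_series c b a d" "config_series a b c d = config_series d b c a"
  by (simp add: config_series_def boundary_poly_commute(1)[of a b c d] mult_ac,
      simp add: config_series_def boundary_poly_commute(2)[of a b c d] mult_ac,
      simp add: config_series_def boundary_poly_commute(3)[of a b c d] mult_ac)

section \<open>Iterating the functional equation modulo powers of q\<close>

text \<open>Congruences modulo q^k, for arbitrary k, take the place of convergence of the
  iteration.\<close>

definition dvd_cong :: "'b::comm_ring_1 \<Rightarrow> 'b \<Rightarrow> 'b \<Rightarrow> bool" where
  "dvd_cong m f g \<longleftrightarrow> m dvd f - g"

lemma dvd_cong_refl [simp]: "dvd_cong m f f"
  by (simp add: dvd_cong_def)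

lemma dvd_cong_trans: "dvd_cong m f g \<Longrightarrow> dvd_cong m g h \<Longrightarrow> dvd_cong m f h"
  unfolding dvd_cong_def using dvd_add[of m "f - g" "g - h"] by simp

lemma dvd_cong_add: "dvd_cong m f g \<Longrightarrow> dvd_cong m f' g' \<Longrightarrow> dvd_cong m (f + f') (g + g')"
  unfolding dvd_cong_def using dvd_add[of m "f - g" "f' - g'"] by (simp add: algebra_simps)

lemma dvd_cong_diff: "dvd_cong m f g \<Longrightarrow> dvd_cong m f' g' \<Longrightarrow> dvd_cong m (f - f') (g - g')"
  unfolding dvd_cong_def using dvd_diff[of m "f - g" "f' - g'"] by (simp add: algebra_simps)

lemma dvd_cong_mult:
  assumes "dvd_cong m f g" "dvd_cong m f' g'"
  shows "dvd_cong m (f * f') (g * g')"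
proof -
  have "f * f' - g * g' = (f - g) * f' + g * (f' - g')" by (simp add: algebra_simps)
  then show ?thesis using assms unfolding dvd_cong_def by simp
qed

lemma dvd_cong_power: "dvd_cong m f g \<Longrightarrow> dvd_cong m (f ^ n) (g ^ n)"
  by (induction n) (auto intro: dvd_cong_mult)

lemma const_dvd_fps:
  fixes f :: "'b::comm_ring_1 fps"
  assumes "\<And>n. c dvd f $ n"
  shows "fps_const c dvd f"
proof -
  have "f = fps_const c * Abs_fps (\<lambda>n. SOME k. f $ n = c * k)"
    using assms by (intro fps_ext) (auto simp: dvd_def intro: someI_ex)
  then show ?thesis by (metis dvd_triv_left)
qed

lemma dvd_cong_const: "dvd_cong m a b \<Longrightarrow> dvd_cong (cc m) (cc a) (cc b)"
  unfolding dvd_cong_def by (intro const_dvd_fps) simp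

text \<open>Every nonzero coefficient in z is a power of the parameter times a fixed series in q, so
  a congruence between parameters carries over.\<close>

lemma dvd_cong_recip_poch: "dvd_cong m a b \<Longrightarrow> dvd_cong (cc m) (recip_poch a) (recip_poch b)"
  and dvd_cong_poch: "dvd_cong m a b \<Longrightarrow> dvd_cong (cc m) (poch a) (poch b)"
  and dvd_cong_recip_poch_sq: "dvd_cong m a b \<Longrightarrow> dvd_cong (cc m) (recip_poch_sq a) (recip_poch_sq b)"
  unfolding dvd_cong_def[of "cc m"]
  by (intro const_dvd_fps;
      auto simp: recip_poch_def poch_def recip_poch_sq_def dvd_cong_def[symmetric] intro!:
          dvd_cong_mult dvd_cong_power)+

lemma dvd_cong_config_series:
  assumes "dvd_cong m a a'"
  shows "dvd_cong (cc m) (config_series a b c d) (config_series a' b c d)"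
  unfolding config_series_def boundary_poly_def
  by (intro dvd_cong_add dvd_cong_diff dvd_cong_mult dvd_cong_power dvd_cong_recip_poch
      dvd_cong_recip_poch_sq dvd_cong_poch
        dvd_cong_const dvd_cong_refl assms)

lemma dvd_cong_stair_sum:
  assumes "dvd_cong (cc m) f g"
  shows "dvd_cong m (stair_sum f) (stair_sum g)"
  using assms unfolding dvd_cong_def by (auto simp: dvd_def stair_sum_diff[symmetric]
      stair_sum_const_mult)

lemma stair_sum_config_series_prod: "stair_sum (config_series a b c d)
    = (\<Prod>m=1..k. 1 + a * fps_X ^ m) * stair_sum (config_series (fps_X ^ k * a) b c d)"
proof (induction k)
  case (Suc k)
  show ?case
    using stair_sum_config_series_rec[of "fps_X ^ k * a" b c d]
    by (subst Suc) (simp add: mult_ac)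
qed simp

text \<open>After k steps the parameter has become q^k a, which is 0 modulo q^k.\<close>

lemma stair_sum_config_series_cong:
  "dvd_cong (fps_X ^ k) (stair_sum (config_series a b c d))
      ((\<Prod>m=1..k. 1 + a * fps_X ^ m) * stair_sum (config_series 0 b c d))"
  unfolding stair_sum_config_series_prod[of a b c d k]
  by (intro dvd_cong_mult dvd_cong_stair_sum dvd_cong_config_series dvd_cong_refl)
      (simp add: dvd_cong_def)

lemma config_series_0: "config_series 0 0 0 0 = 1"
proof -
  have "recip_poch (0 :: 'a fps) = 1" "poch (0 :: 'a fps) = 1" "recip_poch_sq (0 :: 'a fps) = 1"
    by (auto simp: recip_poch_def poch_def recip_poch_sq_def fps_eq_iff power_0_left)
  then show ?thesis by (simp add: config_series_def boundary_poly_def)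
qed

lemma stair_sum_1: "stair_sum 1 = 1"
  by (rule fps_ext) (auto simp: stair_sum_def if_distrib cong: if_cong)

text \<open>Symmetry brings each parameter to the front in turn, where it is driven to 0; with all
  four at 0 the series is 1.\<close>

theorem stair_sum_config_series_cong_prod:
  "dvd_cong (fps_X ^ k) (stair_sum (config_series a b c d))
     (\<Prod>m=1..k. (1 + a * fps_X ^ m) * (1 + b * fps_X ^ m) * (1 + c * fps_X ^ m) *
         (1 + d * fps_X ^ m))"
proof -
  let ?p = "\<lambda>a. \<Prod>m=1..k. 1 + a * fps_X ^ m :: 'a fps"
  have b: "dvd_cong (fps_X ^ k) (stair_sum (config_series 0 b c d))
      (?p b * stair_sum (config_series 0 0 c d))"
    using stair_sum_config_series_cong[of k b 0 c d] config_series_commute(1)[of b 0 c d] by simp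
  have c: "dvd_cong (fps_X ^ k) (stair_sum (config_series 0 0 c d))
      (?p c * stair_sum (config_series 0 0 0 d))"
    using stair_sum_config_series_cong[of k c 0 0 d] config_series_commute(2)[of c 0 0 d] by simp
  have d: "dvd_cong (fps_X ^ k) (stair_sum (config_series 0 0 0 d))
      (?p d * stair_sum (config_series 0 0 0 0))"
    using stair_sum_config_series_cong[of k d 0 0 0] config_series_commute(3)[of d 0 0 0] by simp
  have "dvd_cong (fps_X ^ k) (stair_sum (config_series a b c d))
      (?p a * (?p b * (?p c * (?p d * 1))))"
    using stair_sum_config_series_cong[of k a b c d] b c d unfolding config_series_0 stair_sum_1
    by (meson dvd_cong_mult dvd_cong_refl dvd_cong_trans)
  then show ?thesis by (simp add: prod.distrib mult.assoc)
qed

section \<open>Generating functions of chains\<close>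

definition gf :: "'x set \<Rightarrow> ('x \<Rightarrow> nat) \<Rightarrow> ('x \<Rightarrow> nat) \<Rightarrow> ('x \<Rightarrow> 'p::comm_ring_1) \<Rightarrow> 'p fps fps" where
  "gf X d v w = Abs_fps (\<lambda>m. Abs_fps (\<lambda>n. \<Sum>x \<in> {x\<in>X. d x = m \<and> v x = n}. w x))"

text \<open>Finite fibers guarantee that the sums in \<open>gf\<close> are genuine; over an infinite
  fiber the sum would default to 0.\<close>

definition graded :: "'x set \<Rightarrow> ('x \<Rightarrow> nat) \<Rightarrow> ('x \<Rightarrow> nat) \<Rightarrow> bool" where
  "graded X d v \<longleftrightarrow> (\<forall>m n. finite {x\<in>X. d x = m \<and> v x = n})"

lemma graded_subset:
  assumes "graded Y d v" "X \<subseteq> Y"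
  shows "graded X d v"
  unfolding graded_def
proof (intro allI)
  fix m n
  show "finite {x\<in>X. d x = m \<and> v x = n}"
    by (rule finite_subset[of _ "{x\<in>Y. d x = m \<and> v x = n}"])
      (use assms in \<open>auto simp: graded_def\<close>)
qed

lemma gf_Un:
  assumes "graded X d v" "graded Y d v" "X \<inter> Y = {}"
  shows "gf (X \<union> Y) d v w = gf X d v w + gf Y d v w"
proof (intro fps_ext)
  fix m n
  have "{x \<in> X \<union> Y. d x = m \<and> v x = n} = {x\<in>X. d x = m \<and> v x = n} \<union> {x\<in>Y. d x = m \<and> v x = n}"
    by auto
  then show "gf (X \<union> Y) d v w $ m $ n = (gf X d v w + gf Y d v w) $ m $ n"
    using assms by (simp add: gf_def graded_def) (subst sum.union_disjoint; auto)
qed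

lemma gf_image:
  assumes "inj_on f X"
  shows "gf (f ` X) d v w = gf X (\<lambda>x. d (f x)) (\<lambda>x. v (f x)) (\<lambda>x. w (f x))"
proof (intro fps_ext)
  fix m n
  have "{x \<in> f ` X. d x = m \<and> v x = n} = f ` {x\<in>X. d (f x) = m \<and> v (f x) = n}"
    by auto
  moreover have "inj_on f {x\<in>X. d (f x) = m \<and> v (f x) = n}"
    using assms by (rule inj_on_subset) auto
  ultimately show "gf (f ` X) d v w $ m $ n = gf X (\<lambda>x. d (f x)) (\<lambda>x. v (f x))
      (\<lambda>x. w (f x)) $ m $ n"
    by (simp add: gf_def sum.reindex)
qed

lemma gf_const_mult: "gf X d v (\<lambda>x. c * w x) = cc (fps_const c) * gf X d v w"
  by (intro fps_ext) (simp add: gf_def sum_distrib_left)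

lemma gf_degree_Suc: "gf X (\<lambda>x. Suc (d x)) v w = fps_X * gf X d v w"
proof (intro fps_ext)
  fix m n
  show "gf X (\<lambda>x. Suc (d x)) v w $ m $ n = (fps_X * gf X d v w) $ m $ n"
    by (cases m) (simp_all add: gf_def)
qed

lemma gf_value_add_degree: "gf X d (\<lambda>x. v x + d x) w = qshift (gf X d v w)"
proof (intro fps_ext)
  fix m n
  show "gf X d (\<lambda>x. v x + d x) w $ m $ n = qshift (gf X d v w) $ m $ n"
  proof (cases "n < m")
    case True
    then have "{x \<in> X. d x = m \<and> v x + d x = n} = {}" by auto
    with True show ?thesis by (simp only: gf_def fps_nth_Abs_fps) (simp add: fps_X_power_mult_nth)
  next
    case False
    then show ?thesis by (auto simp: gf_def fps_X_power_mult_nth intro!: sum.cong)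
  qed
qed

lemma gf_double_degree:
  "gf X (\<lambda>x. 2 * d x) v w $ m = (if even m then gf X d v w $ (m div 2) else 0)"
  by (auto simp: gf_def fps_eq_iff intro!: sum.neutral elim!: evenE)

lemma gf_Times:
  assumes "graded X d v" "graded Y d' v'"
  shows "gf (X \<times> Y) (\<lambda>(x, y). d x + d' y) (\<lambda>(x, y). v x + v' y) (\<lambda>(x, y). w x * w' y)
    = gf X d v w * gf Y d' v' w'"
proof (intro fps_ext)
  fix m n
  let ?X = "\<lambda>i j. {x\<in>X. d x = i \<and> v x = j}" and ?Y = "\<lambda>i j. {y\<in>Y. d' y = i \<and> v' y = j}"
  have fin: "finite (?X i j)" "finite (?Y i j)" for i j
    using assms by (auto simp: graded_def)
  have "(gf X d v w * gf Y d' v' w') $ m $ n =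
      (\<Sum>i\<le>m. \<Sum>j\<le>n. (\<Sum>x\<in>?X i j. w x) * (\<Sum>y\<in>?Y (m - i) (n - j). w' y))"
    by (simp add: fps_mult_nth fps_sum_nth gf_def atLeast0AtMost)
  also have "\<dots> = (\<Sum>ij\<in>{..m}\<times>{..n}. \<Sum>(x, y)\<in>?X (fst ij) (snd ij) \<times> ?Y (m - fst ij)
      (n - snd ij). w x * w' y)"
    by (simp add: sum_product sum.cartesian_product)
      (simp add: sum.cartesian_product[symmetric] case_prod_unfold)
  also have "\<dots> = (\<Sum>(x, y)\<in>(\<Union>ij\<in>{..m}\<times>{..n}. ?X (fst ij) (snd ij) \<times> ?Y (m - fst ij) (n - snd ij)).
      w x * w' y)"
    by (subst sum.UNION_disjoint) (auto simp: fin)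
  also have "(\<Union>ij\<in>{..m}\<times>{..n}. ?X (fst ij) (snd ij) \<times> ?Y (m - fst ij) (n - snd ij))
      = {xy \<in> X \<times> Y. (case xy of (x, y) \<Rightarrow> d x + d' y) = m \<and> (case xy of (x, y) \<Rightarrow> v x + v' y) = n}"
    by auto
  finally show "gf (X \<times> Y) (\<lambda>(x, y). d x + d' y) (\<lambda>(x, y). v x + v' y) (\<lambda>(x, y). w x * w' y) $ m $ n
    = (gf X d v w * gf Y d' v' w') $ m $ n"
    by (simp add: gf_def)
qed

lemma finite_stair_sum_fiber:
  assumes "graded X d v"
  shows "finite {x\<in>X. v x + (Suc (d x) choose 2) = n}"
proof -
  have "finite (\<Union>m\<le>n. \<Union>j\<le>n. {x\<in>X. d x = m \<and> v x = j})"
    using assms by (auto simp: graded_def)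
  then show ?thesis
    by (rule finite_subset[rotated]) (auto simp: Suc_choose_2)
qed

text \<open>Here the staircase is put back: \<open>stair_sum\<close> adds the triangular number of
  the degree to the value of each object.\<close>

lemma stair_sum_gf_nth:
  assumes "graded X d v"
  shows "stair_sum (gf X d v w) $ n = (\<Sum>x\<in>{x\<in>X. v x + (Suc (d x) choose 2) = n}. w x)"
proof -
  have ge: "m \<le> Suc m choose 2" for m by (simp add: Suc_choose_2)
  have "stair_sum (gf X d v w) $ n = (\<Sum>m\<le>n. (fps_X ^ (Suc m choose 2) * gf X d v w $ m) $ n)"
    by (simp add: stair_sum_def fps_sum_nth)
  also have "\<dots> = (\<Sum>m\<le>n. \<Sum>x\<in>{x\<in>X. d x = m \<and> v x + (Suc m choose 2) = n}. w x)"
  proof (intro sum.cong refl)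
    fix m
    have "{x\<in>X. d x = m \<and> v x + (Suc m choose 2) = n} =
        (if n < Suc m choose 2 then {} else {x\<in>X. d x = m \<and> v x = n - (Suc m choose 2)})"
      by auto
    then show "(fps_X ^ (Suc m choose 2) * gf X d v w $ m) $ n =
        (\<Sum>x\<in>{x\<in>X. d x = m \<and> v x + (Suc m choose 2) = n}. w x)"
      by (simp add: fps_X_power_mult_nth gf_def)
  qed
  also have "\<dots> = (\<Sum>x\<in>(\<Union>m\<le>n. {x\<in>X. d x = m \<and> v x + (Suc m choose 2) = n}). w x)"
  proof (rule sum.UNION_disjoint[symmetric])
    have "finite {x \<in> X. d x = m \<and> v x + (Suc m choose 2) = n}" for m
      by (rule finite_subset[OF _ finite_stair_sum_fiber[OF assms, of n]]) auto
    then show "\<forall>i\<in>{..n}. finite {x \<in> X. d x = i \<and> v x + (Suc i choose 2) = n}" by blast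
  qed auto
  also have "(\<Union>m\<le>n. {x\<in>X. d x = m \<and> v x + (Suc m choose 2) = n})
      = {x\<in>X. v x + (Suc (d x) choose 2) = n}"
    using ge by (auto intro: trans_le_add2)
  finally show ?thesis .
qed

section \<open>Chains of colored integers\<close>

text \<open>What remains of the difference condition on neighbors after the staircase is subtracted.
  The clause \<open>\<not> secondary\<close>, in place of \<open>primary\<close>, lets the same
  relation serve for chains of color ABCD, where repetition is allowed.\<close>

definition part_le :: "part \<Rightarrow> part \<Rightarrow> bool" where
  "part_le u v \<longleftrightarrow> fst u < fst v \<or> fst u = fst v \<and>
     (rank (snd u) < rank (snd v) \<or> snd u = snd v \<and> \<not> secondary (snd u))"

text \<open>The threshold \<open>r\<close> restricts the colors of the entries with value 0 only.\<close>

definition chain_lists :: "color set \<Rightarrow> nat \<Rightarrow> part list set" where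
  "chain_lists K r = {us. sorted_wrt part_le us \<and> snd ` set us \<subseteq> K
      \<and> (\<forall>u\<in>set us. fst u = 0 \<longrightarrow> r \<le> rank (snd u))}"

definition total_value :: "part list \<Rightarrow> nat" where
  "total_value us = sum_list (map fst us)"

definition weight :: "(color \<Rightarrow> 'p::comm_ring_1) \<Rightarrow> part list \<Rightarrow> 'p" where
  "weight W us = prod_list (map (\<lambda>u. W (snd u)) us)"

lemma total_value_Cons [simp]: "total_value (u # us) = fst u + total_value us"
  and weight_Cons [simp]: "weight W (u # us) = W (snd u) * weight W us"
  by (simp_all add: total_value_def weight_def)

lemma rank_inject: "rank c = rank c' \<longleftrightarrow> c = c'"
  by (cases c; cases c') simp_all

lemma UNIV_color: "UNIV = {A, B, C, D, AB, AC, AD, BC, BD, CD, ABCD}"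
  by (rule set_eqI, case_tac x) simp_all

lemma finite_color [simp]: "finite (X :: color set)"
  by (rule finite_subset[OF subset_UNIV]) (simp add: UNIV_color)

lemma graded_length:
  assumes "0 < k"
  shows "graded X (\<lambda>us. k * length us) total_value"
  unfolding graded_def
proof (intro allI)
  fix m n
  have "{us\<in>X. k * length us = m \<and> total_value us = n}
      \<subseteq> {us. set us \<subseteq> {..n} \<times> UNIV \<and> length us \<le> m}"
    using assms by (force simp: total_value_def intro!: member_le_sum_list)
  moreover have "finite {us. set us \<subseteq> {..n} \<times> (UNIV :: color set) \<and> length us \<le> m}"
    by (rule finite_lists_length_le) simp
  ultimately show "finite {us\<in>X. k * length us = m \<and> total_value us = n}"
    by (rule finite_subset)
qed

abbreviation list_gf :: "(color \<Rightarrow> 'p::comm_ring_1) \<Rightarrow> part list set \<Rightarrow> 'p fps fps" where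
  "list_gf W X \<equiv> gf X length total_value (weight W)"

lemma graded_length1: "graded X length total_value"
  using graded_length[of 1 X] by simp

lemma list_gf_Cons: "list_gf W (Cons (0, c) ` X) = cc (fps_const (W c)) * (fps_X * list_gf W X)"
proof -
  have "list_gf W (Cons (0, c) ` X)
      = gf X (\<lambda>us. Suc (length us)) total_value (\<lambda>us. W c * weight W us)"
    by (subst gf_image) simp_all
  then show ?thesis by (simp only: gf_const_mult gf_degree_Suc)
qed

lemma list_gf_Suc: "list_gf W (map (apfst Suc) ` X) = qshift (list_gf W X)"
proof -
  have "total_value (map (apfst Suc) us) = total_value us + length us" for us
    by (induction us) (auto simp: total_value_def)
  moreover have "weight W (map (apfst Suc) us) = weight W us" for us
    by (simp add: weight_def o_def)
  moreover have "inj_on (map (apfst Suc)) (X :: part list set)"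
  proof (rule inj_on_subset[OF inj_mapI])
    show "inj (apfst Suc :: part \<Rightarrow> part)" by (auto simp: inj_def)
  qed simp
  ultimately have "list_gf W (map (apfst Suc) ` X)
      = gf X length (\<lambda>us. total_value us + length us) (weight W)"
    by (simp only: gf_image length_map)
  then show ?thesis by (simp only: gf_value_add_degree)
qed

lemma chain_lists_step:
  assumes "c \<in> K"
  shows "chain_lists K (rank c) = chain_lists K (Suc (rank c)) \<union>
     Cons (0, c) ` chain_lists K (if secondary c then Suc (rank c) else rank c)"
    and "chain_lists K (Suc (rank c)) \<inter> Cons (0, c) ` X = {}"
proof -
  show "chain_lists K (Suc (rank c)) \<inter> Cons (0, c) ` X = {}"
    by (auto simp: chain_lists_def)
  show "chain_lists K (rank c) = chain_lists K (Suc (rank c)) \<union>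
     Cons (0, c) ` chain_lists K (if secondary c then Suc (rank c) else rank c)" (is "_ = ?L \<union> ?R")
  proof (intro equalityI subsetI)
    fix us assume us: "us \<in> chain_lists K (rank c)"
    show "us \<in> ?L \<union> ?R"
    proof (cases "us \<in> ?L")
      case False
      then obtain u where "u \<in> set us" "fst u = 0" "\<not> rank c < rank (snd u)"
        using us by (auto simp: chain_lists_def less_eq_Suc_le)
      with us have "snd u = c"
        by (auto simp: chain_lists_def rank_inject[symmetric])
      with \<open>u \<in> set us\<close> \<open>fst u = 0\<close> have mem: "(0, c) \<in> set us"
        by (metis prod.collapse)
      then obtain u0 us' where us': "us = u0 # us'" by (cases us) auto
      have "rank c \<le> rank (snd u0)" if "fst u0 = 0"
        using us that by (simp add: chain_lists_def us')
      moreover have "u0 = (0, c) \<or> part_le u0 (0, c)"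
        using us mem by (auto simp: chain_lists_def us')
      ultimately have u0: "u0 = (0, c)"
        by (cases u0) (auto simp: part_le_def)
      have "us' \<in> chain_lists K (if secondary c then Suc (rank c) else rank c)"
        using us unfolding us' u0 by (auto simp: chain_lists_def part_le_def Suc_le_eq)
      then show ?thesis unfolding us' u0 by (intro UnI2 imageI)
    qed simp
  next
    fix us assume "us \<in> ?L \<union> ?R"
    then consider "us \<in> ?L" | us' where "us = (0, c) # us'"
        "us' \<in> chain_lists K (if secondary c then Suc (rank c) else rank c)"
      by blast
    then show "us \<in> chain_lists K (rank c)"
    proof cases
      case 1
      then show ?thesis by (auto simp: chain_lists_def Suc_le_eq less_imp_le)
    next
      case (2 us')
      have ge: "(if secondary c then Suc (rank c) else rank c) \<le> rank (snd u)"
        if "u \<in> set us'" "fst u = 0" for u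
        using 2(2) that by (simp add: chain_lists_def)
      have "rank c \<le> rank (snd u)" if "u \<in> set us'" "fst u = 0" for u
        using ge[OF that] by (simp split: if_splits)
      moreover have "part_le (0, c) u" if "u \<in> set us'" for u
      proof (cases "fst u = 0")
        case True
        show ?thesis
        proof (cases "snd u = c")
          case False
          then have "rank c \<noteq> rank (snd u)" by (simp add: rank_inject)
          with ge[OF that True] True show ?thesis by (simp add: part_le_def split: if_splits)
        qed (use ge[OF that True] True in \<open>simp add: part_le_def split: if_splits\<close>)
      qed (simp add: part_le_def)
      ultimately show ?thesis
        using 2(2) assms unfolding 2(1) by (simp add: chain_lists_def)
    qed
  qed
qed

lemma list_gf_step:
  assumes "c \<in> K"
  shows "list_gf W (chain_lists K (rank c)) = list_gf W (chain_lists K (Suc (rank c)))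
     + cc (fps_const (W c)) * (fps_X * list_gf W
         (chain_lists K (if secondary c then Suc (rank c) else rank c)))"
  by (subst chain_lists_step(1)[OF assms], subst gf_Un)
    (simp_all only: graded_length1 chain_lists_step(2)[OF assms] list_gf_Cons)

lemma list_gf_primary:
  assumes "c \<in> K" "\<not> secondary c"
  shows "(1 - cc (fps_const (W c)) * fps_X) * list_gf W (chain_lists K (rank c))
      = list_gf W (chain_lists K (Suc (rank c)))"
  using list_gf_step[OF assms(1), of W] assms(2)
  by (simp only: if_False diff_eq_eq left_diff_distrib mult_1_left mult.assoc)

lemma list_gf_secondary:
  assumes "c \<in> K" "secondary c"
  shows "list_gf W (chain_lists K (rank c)) = (1 + cc (fps_const (W c)) * fps_X) * list_gf W
      (chain_lists K (Suc (rank c)))"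
  using list_gf_step[OF assms(1), of W] assms(2)
  by (simp only: if_True distrib_right mult_1_left mult.assoc)

lemma rank_le_10: "rank c \<le> 10"
  by (cases c) simp_all

text \<open>A threshold above all ranks forbids the value 0, and lowering every value by 1 gives
  back unrestricted chains. This closes the passage through the colors into a functional equation
  under z -> q z.\<close>

lemma chain_lists_eq_image_Suc:
  assumes "\<forall>c\<in>K. rank c < r"
  shows "chain_lists K r = map (apfst Suc) ` chain_lists K 0"
proof (intro equalityI subsetI)
  fix us assume us: "us \<in> chain_lists K r"
  then have pos: "0 < fst u" if "u \<in> set us" for u
    using assms that by (fastforce simp: chain_lists_def)
  have "map (apfst Suc) (map (apfst (\<lambda>s. s - 1)) us) = us"
    unfolding map_map by (rule map_idI) (use pos in \<open>force simp: apfst_def map_prod_def\<close>)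
  moreover have "map (apfst (\<lambda>s. s - 1)) us \<in> chain_lists K 0"
  proof -
    have "sorted_wrt (\<lambda>u v. part_le (apfst (\<lambda>s. s - 1) u) (apfst (\<lambda>s. s - 1) v)) us"
    proof (rule sorted_wrt_mono_rel[of us part_le])
      fix u v assume "u \<in> set us" "v \<in> set us" "part_le u v"
      then show "part_le (apfst (\<lambda>s. s - 1) u) (apfst (\<lambda>s. s - 1) v)"
        using pos[of u] pos[of v] by (auto simp: part_le_def)
    qed (use us in \<open>simp add: chain_lists_def\<close>)
    then show ?thesis
      using us by (auto simp: chain_lists_def sorted_wrt_map)
  qed
  ultimately show "us \<in> map (apfst Suc) ` chain_lists K 0" by (metis image_eqI)
next
  fix us assume "us \<in> map (apfst Suc) ` chain_lists K 0"
  then obtain us' where "us = map (apfst Suc) us'" "us' \<in> chain_lists K 0" by blast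
  moreover have "part_le (apfst Suc u) (apfst Suc v) = part_le u v" for u v
    by (simp add: part_le_def)
  ultimately show "us \<in> chain_lists K r"
    by (simp add: chain_lists_def sorted_wrt_map image_image)
qed

abbreviation nonquat :: "color set" where
  "nonquat \<equiv> - {ABCD}"

lemma list_gf_quaternary:
  "list_gf W (chain_lists {ABCD} 0) = recip_poch (fps_const (W ABCD))"
  "list_gf W (chain_lists {ABCD} 1) = qshift (recip_poch (fps_const (W ABCD)))"
proof -
  let ?f = "list_gf W (chain_lists {ABCD} 0)"
  have shift: "list_gf W (chain_lists {ABCD} 1) = qshift ?f"
    by (subst chain_lists_eq_image_Suc) (simp_all add: list_gf_Suc)
  then have "(1 - cc (fps_const (W ABCD)) * fps_X) * ?f = 1 * qshift ?f"
    using list_gf_primary[of ABCD "{ABCD}" W] by (simp add: secondary_def)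
  moreover have "?f $ 0 = recip_poch (fps_const (W ABCD)) $ 0"
  proof -
    have "{us \<in> chain_lists {ABCD} 0. length us = 0 \<and> total_value us = n}
        = (if n = 0 then {[]} else {})" for n
      by (auto simp: chain_lists_def total_value_def)
    then show ?thesis by (simp add: gf_def fps_eq_iff weight_def)
  qed
  ultimately show "?f = recip_poch (fps_const (W ABCD))"
    using qshift_unique[of "1 - cc (fps_const (W ABCD)) * fps_X" ?f 1 "recip_poch
        (fps_const (W ABCD))"]
    by (simp add: recip_poch_rec)
  with shift show "list_gf W (chain_lists {ABCD} 1) = qshift (recip_poch (fps_const (W ABCD)))"
      by simp
qed

lemma chain_lists_nonquat_0: "chain_lists nonquat 0 = chain_lists nonquat 1"
proof (intro equalityI subsetI)
  fix us assume us: "us \<in> chain_lists nonquat 0"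
  have "1 \<le> rank (snd u)" if "u \<in> set us" for u
  proof -
    have "snd u \<in> nonquat" using us that unfolding chain_lists_def by blast
    then show ?thesis by (cases "snd u") simp_all
  qed
  then show "us \<in> chain_lists nonquat 1" using us by (simp add: chain_lists_def)
qed (simp add: chain_lists_def)

text \<open>The left side lists the beginnings of a configuration, with common factors removed: head
  \<open>(0, A)\<close>; or else head \<open>(0, B)\<close>, or value 0 only in C and D. The factor
  1 - abcd z^2 reflects the higher bound on the quaternary parts when A_1 is absent.\<close>

lemma boundary_identity:
  fixes a b c d z :: "'a::comm_ring_1"
  shows "a*z*(1 + b*c*z)*(1 + b*d*z)*(1 + c*d*z)
      + (1 - a*z)*(1 - a*b*c*d*z^2)*(b*z*(1 + c*d*z) + (1 - b*z))
    = 1 + (a*b*c + a*b*d + a*c*d + b*c*d - a*b*c*d)*z^2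
      + (a*b*c*d*(a + b + c + d) - a*b*c*d)*z^3 + (a*b*c*d)^2*z^5"
  by (simp add: algebra_simps eval_nat_numeral)

lemma list_gf_nth_0: "list_gf W (chain_lists K r) $ 0 = 1"
proof -
  have "{us \<in> chain_lists K r. length us = 0 \<and> total_value us = n}
      = (if n = 0 then {[]} else {})" for n
    by (auto simp: chain_lists_def total_value_def)
  then show ?thesis by (simp add: gf_def fps_eq_iff weight_def)
qed

section \<open>Closed forms for the series of chains\<close>

locale primary_weights =
  fixes W :: "color \<Rightarrow> 'p::comm_ring_1"
  assumes W_mult: "W AB = W A * W B" "W AC = W A * W C" "W AD = W A * W D"
    "W BC = W B * W C" "W BD = W B * W D" "W CD = W C * W D"
    "W ABCD = W A * W B * W C * W D"
begin

abbreviation w :: "color \<Rightarrow> 'p fps fps" where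
  "w c \<equiv> cc (fps_const (W c)) * fps_X"

abbreviation \<Phi> :: "nat \<Rightarrow> 'p fps fps" where
  "\<Phi> r \<equiv> list_gf W (chain_lists nonquat r)"

definition color_recip :: "color \<Rightarrow> 'p fps fps" where
  "color_recip c = recip_poch (fps_const (W c))"

definition color_poch :: "color \<Rightarrow> 'p fps fps" where
  "color_poch c = poch (fps_const (W c))"

text \<open>Chosen so that \<open>\<Phi> r\<close> is a polynomial multiple of it for every
  threshold up to 11.\<close>

definition nonquat_core :: "'p fps fps" where
  "nonquat_core = color_recip A * color_recip B * color_recip C * color_recip D *
      (qshift (color_poch AB) * qshift (color_poch AC) * qshift (color_poch AD)
        * (qshift (color_poch BC) * qshift (color_poch BD) * qshift (color_poch CD)))"

lemma color_recip: "qshift (color_recip c) = (1 - w c) * color_recip c"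
  unfolding color_recip_def by (rule recip_poch_rec[symmetric])

lemma color_poch: "color_poch c = (1 + w c) * qshift (color_poch c)"
  unfolding color_poch_def by (rule poch_rec)

lemma \<Phi>_secondary:
  assumes "secondary c" "rank c = r" "Suc r = r'"
  shows "\<Phi> r = (1 + w c) * \<Phi> r'"
proof -
  have "c \<in> nonquat" using assms(1) by (auto simp: secondary_def)
  then show ?thesis using list_gf_secondary[of c nonquat W] assms by (simp only:)
qed

lemma \<Phi>_primary:
  assumes "primary c" "rank c = r" "Suc r = r'"
  shows "(1 - w c) * \<Phi> r = \<Phi> r'"
proof -
  have "c \<in> nonquat" "\<not> secondary c" using assms(1) by (auto simp: primary_def secondary_def)
  then show ?thesis using list_gf_primary[of c nonquat W] assms by (simp only: not_False_eq_True)
qed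

lemma \<Phi>_steps:
  "\<Phi> 1 = (1 + w AB) * \<Phi> 2" "\<Phi> 2 = (1 + w AC) * \<Phi> 3" "\<Phi> 3 = (1 + w AD) * \<Phi> 4"
  "(1 - w A) * \<Phi> 4 = \<Phi> 5" "\<Phi> 5 = (1 + w BC) * \<Phi> 6" "\<Phi> 6 = (1 + w BD) * \<Phi> 7"
  "(1 - w B) * \<Phi> 7 = \<Phi> 8" "\<Phi> 8 = (1 + w CD) * \<Phi> 9"
  "(1 - w C) * \<Phi> 9 = \<Phi> 10" "(1 - w D) * \<Phi> 10 = \<Phi> 11"
  by (rule \<Phi>_secondary \<Phi>_primary; simp add: secondary_def primary_def)+

text \<open>Passing through all ten colors relates \<open>\<Phi> 0\<close> to
  \<open>\<Phi> 11\<close>, which is \<open>\<Phi> 0\<close> at q z. The product \<open>G\<close>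
  satisfies the same functional equation, and \<open>qshift_unique\<close> identifies the
  two.\<close>

lemma \<Phi>_11: "\<Phi> 11 = (1 - w A) * (1 - w B) * (1 - w C) * (1 - w D) * nonquat_core"
proof -
  define p where "p = (1 - w A) * (1 - w B) * (1 - w C) * (1 - w D)"
  define r where "r = (1 + w AB) * (1 + w AC) * (1 + w AD) * ((1 + w BC) * (1 + w BD) * (1 + w CD))"
  define G where "G = color_recip A * color_recip B * color_recip C * color_recip D *
      (color_poch AB * color_poch AC * color_poch AD *
          (color_poch BC * color_poch BD * color_poch CD))"
  have 11: "\<Phi> 11 = qshift (\<Phi> 0)"
  proof -
    have "\<forall>c\<in>nonquat. rank c < 11" using rank_le_10 by (simp add: less_Suc_eq_le[symmetric])
    then show ?thesis by (simp only: chain_lists_eq_image_Suc list_gf_Suc)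
  qed
  have "p * \<Phi> 0 = (1 + w AB) * (1 + w AC) * (1 + w AD) * (1 - w B) * (1 - w C) * (1 - w D) *
      ((1 - w A) * \<Phi> 4)"
    unfolding chain_lists_nonquat_0 \<Phi>_steps(1-3) p_def by (simp only: mult_ac)
  also have "\<dots> = (1 + w AB) * (1 + w AC) * (1 + w AD) * (1 + w BC) * (1 + w BD) * (1 - w C) *
      (1 - w D) * ((1 - w B) * \<Phi> 7)"
    unfolding \<Phi>_steps(4-6) by (simp only: mult_ac)
  also have "\<dots> = r * ((1 - w D) * ((1 - w C) * \<Phi> 9))"
    unfolding \<Phi>_steps(7-8) r_def by (simp only: mult_ac)
  finally have p\<Phi>: "p * \<Phi> 0 = r * qshift (\<Phi> 0)"
    unfolding \<Phi>_steps(9-10) 11 .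
  have qG: "qshift G = p * nonquat_core"
    unfolding G_def nonquat_core_def p_def qshift_mult color_recip by (simp only: mult_ac)
  have G: "G = r * nonquat_core"
    unfolding G_def nonquat_core_def r_def
    by (subst color_poch[of AB], subst color_poch[of AC], subst color_poch[of AD], subst
        color_poch[of BC], subst color_poch[of BD], subst color_poch[of CD])
      (simp only: mult_ac)
  have pG: "p * G = r * qshift G"
    unfolding qG unfolding G by (simp only: mult_ac)
  have "\<Phi> 0 $ 0 = G $ 0"
    by (simp add: list_gf_nth_0 G_def color_recip_def color_poch_def)
  moreover have "p $ 0 = 1" "r $ 0 = 1"
    by (simp_all add: p_def r_def)
  ultimately have "\<Phi> 0 = G"
    by (intro qshift_unique[OF p\<Phi> pG])
  then show ?thesis
    unfolding 11 qG[symmetric, unfolded p_def] by simp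
qed

lemma cancel: "(1 - w c) * f = (1 - w c) * g \<Longrightarrow> f = g"
  by (rule fps_left_cancel_unit) auto

text \<open>These are the thresholds used in \<open>start_A\<close> and \<open>start_other\<close>,
  reached downward from 11 by cancelling the units 1 - \<open>w c\<close> of the primary
  colors.\<close>

lemma \<Phi>_values:
  "\<Phi> 9 = (1 - w A) * (1 - w B) * nonquat_core"
  "\<Phi> 7 = (1 - w A) * (1 + w CD) * nonquat_core"
  "\<Phi> 4 = (1 + w BC) * (1 + w BD) * (1 + w CD) * nonquat_core"
proof -
  have "(1 - w D) * ((1 - w C) * \<Phi> 9) = (1 - w D) *
      ((1 - w C) * ((1 - w A) * (1 - w B) * nonquat_core))"
    unfolding \<Phi>_steps(9,10) \<Phi>_11 by (simp only: mult_ac)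
  then show 9: "\<Phi> 9 = (1 - w A) * (1 - w B) * nonquat_core"
    by (rule cancel[of C, OF cancel[of D]])
  have "(1 - w B) * \<Phi> 7 = (1 - w B) * ((1 - w A) * (1 + w CD) * nonquat_core)"
    unfolding \<Phi>_steps(7,8) 9 by (simp only: mult_ac)
  then show 7: "\<Phi> 7 = (1 - w A) * (1 + w CD) * nonquat_core"
    by (rule cancel)
  have "(1 - w A) * \<Phi> 4 = (1 - w A) * ((1 + w BC) * (1 + w BD) * (1 + w CD) * nonquat_core)"
    unfolding \<Phi>_steps(4-6) 7 by (simp only: mult_ac)
  then show "\<Phi> 4 = (1 + w BC) * (1 + w BD) * (1 + w CD) * nonquat_core"
    by (rule cancel)
qed

definition quat :: "nat \<Rightarrow> 'p fps fps" where
  "quat r = gf (chain_lists {ABCD} r) (\<lambda>vs. 2 * length vs) total_value (weight W)"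

lemma quat_0: "quat 0 = recip_poch_sq (fps_const (W ABCD))"
  by (rule fps_ext) (simp add: quat_def gf_double_degree recip_poch_sq_def list_gf_quaternary)

lemma quat_1: "quat 1 = (1 - cc (fps_const (W ABCD)) * fps_X ^ 2) * quat 0"
proof -
  have "quat 1 = recip_poch_sq (fps_X * fps_const (W ABCD))"
    by (rule fps_ext) (simp add: quat_def gf_double_degree recip_poch_sq_def
        list_gf_quaternary(2)[unfolded One_nat_def] recip_poch_shift)
  then show ?thesis by (simp only: recip_poch_sq_shift quat_0)
qed

end

text \<open>
  Entry \<open>(s, c)\<close> at the head of a chain of non-quaternary entries becomes the part \<open>s + 1\<close>. A
  secondary color with \<open>s = 0\<close> is therefore impossible, and the head \<open>(0, A)\<close> stands for the part
  \<open>A\<^sub>1\<close>, which lowers the bound for the quaternary parts by one.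
\<close>

definition start_A :: "part list set" where
  "start_A = Cons (0, A) ` chain_lists nonquat 4"

text \<open>The color CD has rank 8: it may follow \<open>(0, B)\<close> at value 0 but cannot
  itself be a head of value 0. Hence the threshold 7 after a head B, and 9, leaving C and D,
  otherwise.\<close>

definition start_other :: "part list set" where
  "start_other = Cons (0, B) ` chain_lists nonquat 7 \<union> chain_lists nonquat 9"

text \<open>As ABCD has rank 0, threshold 1 excludes quaternary entries of value 0. Such an entry
  stands for a part 3 + 2\<tau>, permitted only in the presence of A_1.\<close>

definition configs :: "(part list \<times> part list) set" where
  "configs = start_A \<times> chain_lists {ABCD} 0 \<union> start_other \<times> chain_lists {ABCD} 1"

abbreviation config_degree :: "part list \<times> part list \<Rightarrow> nat" where
  "config_degree \<equiv> \<lambda>(us, vs). length us + 2 * length vs"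

abbreviation config_value :: "part list \<times> part list \<Rightarrow> nat" where
  "config_value \<equiv> \<lambda>(us, vs). total_value us + total_value vs"

abbreviation config_weight :: "(color \<Rightarrow> 'p::comm_ring_1) \<Rightarrow> part list \<times> part list \<Rightarrow> 'p" where
  "config_weight W \<equiv> \<lambda>(us, vs). weight W us * weight W vs"

lemma graded_Times:
  assumes "graded X d v" "graded Y d' v'"
  shows "graded (X \<times> Y) (\<lambda>(x, y). d x + d' y) (\<lambda>(x, y). v x + v' y)"
  unfolding graded_def
proof (intro allI)
  fix m n
  let ?F = "\<Union>i\<le>m. \<Union>j\<le>n. {x\<in>X. d x = i \<and> v x = j} \<times> {y\<in>Y. d' y = m - i \<and> v' y = n - j}"
  have "finite ?F"
    using assms by (auto simp: graded_def)
  then show "finite {xy \<in> X \<times> Y. (case xy of (x, y) \<Rightarrow> d x + d' y) = m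
      \<and> (case xy of (x, y) \<Rightarrow> v x + v' y) = n}"
    by (rule finite_subset[rotated]) auto
qed

lemma graded_configs: "graded X config_degree config_value"
  by (rule graded_subset[OF graded_Times[OF graded_length1[of UNIV] graded_length[of 2 UNIV]]])
      simp_all

lemma (in primary_weights) gf_configs:
  "gf configs config_degree config_value (config_weight W)
    = config_series (fps_const (W A)) (fps_const (W B)) (fps_const (W C)) (fps_const (W D))"
proof -
  have disj: "start_A \<inter> start_other = {}"
    by (auto simp: start_A_def start_other_def chain_lists_def)
  have B: "Cons (0, B) ` chain_lists nonquat 7 \<inter> chain_lists nonquat 9 = {}"
    by (auto simp: chain_lists_def)
  have A: "list_gf W start_A = w A * \<Phi> 4"
    unfolding start_A_def list_gf_Cons by (simp only: mult.assoc)
  have O: "list_gf W start_other = w B * \<Phi> 7 + \<Phi> 9"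
    unfolding start_other_def
    by (simp only: gf_Un[OF graded_length1 graded_length1 B] list_gf_Cons mult.assoc)
  have "gf configs config_degree config_value (config_weight W)
      = gf (start_A \<times> chain_lists {ABCD} 0) config_degree config_value (config_weight W)
      + gf (start_other \<times> chain_lists {ABCD} 1) config_degree config_value (config_weight W)"
    unfolding configs_def by (rule gf_Un[OF graded_configs graded_configs]) (use disj in blast)
  also have "\<dots> = list_gf W start_A * quat 0 + list_gf W start_other * quat 1"
    unfolding quat_def by (simp only: gf_Times[OF graded_length1 graded_length[of 2, simplified]])
  also have "\<dots> = (w A * (1 + w BC) * (1 + w BD) * (1 + w CD)
      + (1 - w A) * (1 - cc (fps_const (W ABCD)) * fps_X ^ 2) * (w B * (1 + w CD) + (1 - w B)))
          * nonquat_core * quat 0"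
    unfolding A O \<Phi>_values quat_1 by (simp only: distrib_left distrib_right mult_ac add_ac)
  also have "w A * (1 + w BC) * (1 + w BD) * (1 + w CD)
      + (1 - w A) * (1 - cc (fps_const (W ABCD)) * fps_X ^ 2) * (w B * (1 + w CD) + (1 - w B))
     = boundary_poly (fps_const (W A)) (fps_const (W B)) (fps_const (W C)) (fps_const (W D))"
    unfolding boundary_poly_def boundary_identity[symmetric] W_mult fps_const_mult[symmetric]
    by (simp only: mult_ac)
  also have "boundary_poly (fps_const (W A)) (fps_const (W B)) (fps_const (W C)) (fps_const (W D))
      * nonquat_core * quat 0
     = config_series (fps_const (W A)) (fps_const (W B)) (fps_const (W C)) (fps_const (W D))"
    unfolding config_series_def nonquat_core_def color_recip_def color_poch_def quat_0
        poch_shift[symmetric] W_mult fps_const_mult[symmetric]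
    by (simp only: mult_ac)
  finally show ?thesis .
qed

section \<open>Removing the staircase\<close>

primrec stair :: "nat \<Rightarrow> nat \<Rightarrow> part list \<Rightarrow> part list" where
  "stair k d [] = []"
| "stair k d (u # us) = (fst u + k, snd u) # stair (k + d) d us"

text \<open>For d = 1 this is condition (i) on non-quaternary parts. For d = 4 and color ABCD alone
  the color clause always holds, which leaves condition (ii).\<close>

definition gap :: "nat \<Rightarrow> part \<Rightarrow> part \<Rightarrow> bool" where
  "gap d u v \<longleftrightarrow> fst u + d \<le> fst v \<and> (fst v = fst u + d \<longrightarrow>
     rank (snd u) < rank (snd v) \<or> snd u = snd v \<and> \<not> secondary (snd u))"

lemma length_stair [simp]: "length (stair k d us) = length us"
  by (induction us arbitrary: k) simp_all

lemma map_snd_stair [simp]: "map snd (stair k d us) = map snd us"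
  by (induction us arbitrary: k) simp_all

lemma snd_set_stair [simp]: "snd ` set (stair k d us) = snd ` set us"
  by (metis map_snd_stair set_map)

lemma stair_eq_Nil_iff [simp]: "stair k d us = [] \<longleftrightarrow> us = []"
  by (cases us) simp_all

lemma hd_stair: "us \<noteq> [] \<Longrightarrow> hd (stair k d us) = (fst (hd us) + k, snd (hd us))"
  by (cases us) simp_all

lemma total_value_stair:
  "total_value (stair k d us) = total_value us + k * length us + d * (length us choose 2)"
  by (induction us arbitrary: k) (simp_all add: total_value_def Suc_choose_2 algebra_simps)

lemma weight_stair: "weight W (stair k d us) = weight W us"
  by (induction us arbitrary: k) (simp_all add: weight_def)

lemma stair_inject [simp]: "stair k d us = stair k d us' \<longleftrightarrow> us = us'"
proof (induction us arbitrary: us' k)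
  case Nil
  then show ?case by (cases us') simp_all
next
  case (Cons u us)
  then show ?case by (cases us') (auto simp: prod_eq_iff)
qed

lemma gap_stair: "successively (gap d) (stair k d us) \<longleftrightarrow> successively part_le us"
proof (induction us arbitrary: k)
  case (Cons u us)
  then show ?case
    by (cases us) (auto simp: gap_def part_le_def)
qed simp

text \<open>The gaps leave room for the staircase: if the head is at least k, the next entry is at
  least k + d, so the subtraction never falls below 0.\<close>

lemma stair_surj:
  assumes "successively (gap d) xs" "xs \<noteq> [] \<Longrightarrow> k \<le> fst (hd xs)"
  obtains us where "xs = stair k d us"
proof -
  have "\<exists>us. xs = stair k d us"
    using assms
  proof (induction xs arbitrary: k)
    case Nil
    show ?case by (rule exI[of _ "[]"]) simp
  next
    case (Cons x xs)
    have k: "k \<le> fst x" using Cons.prems(2) by simp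
    have "xs \<noteq> [] \<Longrightarrow> k + d \<le> fst (hd xs)" "successively (gap d) xs"
      using Cons.prems(1) k by (auto simp: successively_Cons gap_def)
    from Cons.IH[OF this(2,1)] obtain us where "xs = stair (k + d) d us" by blast
    with k show ?case by (intro exI[of _ "(fst x - k, snd x) # us"]) simp
  qed
  then show thesis using that by blast
qed

lemma transp_part_le: "transp part_le"
  by (rule transpI) (auto simp: part_le_def)

lemma sorted_wrt_part_le_iff: "sorted_wrt part_le us \<longleftrightarrow> successively (gap d) (stair k d us)"
  using successively_conv_sorted_wrt[OF transp_part_le] gap_stair by blast

lemma fst_ge_stair:
  assumes "p \<in> set (stair k d us)" "sorted_wrt part_le us"
  shows "fst (hd us) + k \<le> fst p"
  using assms
proof (induction us arbitrary: k)
  case (Cons u us)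
  show ?case
  proof (cases "p \<in> set (stair (k + d) d us)")
    case True
    then have "us \<noteq> []" by auto
    then have "part_le u (hd us)" using Cons.prems(2) by simp
    then have "fst u \<le> fst (hd us)" by (auto simp: part_le_def)
    then show ?thesis using Cons.IH[OF True] Cons.prems(2) by simp
  next
    case False
    then show ?thesis using Cons.prems by simp
  qed
qed simp

lemma fst_ge_stair': "p \<in> set (stair k d us) \<Longrightarrow> k \<le> fst p"
  by (induction us arbitrary: k) (auto dest: add_leD1)

section \<open>Sorted lists of parts and the difference conditions\<close>

lemma inj_pkey: "inj pkey"
  by (auto simp: inj_def pkey_def rank_inject prod_eq_iff)

lemma sorted_pkey_unique:
  assumes "mset xs = mset ys" "sorted (map pkey xs)" "sorted (map pkey ys)"
  shows "xs = ys"
proof -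
  have "map pkey xs = map pkey ys"
    using assms by (metis mset_map properties_for_sort sorted_sort_id)
  then show ?thesis using inj_pkey by (simp add: inj_map_eq_map)
qed

lemma sorted_pkey_gap:
  assumes "successively (gap d) xs" "0 < d"
  shows "sorted (map pkey xs)"
proof -
  have "successively (\<lambda>x y. pkey x \<le> pkey y) xs"
    by (rule successively_mono[OF assms(1)]) (use assms(2) in \<open>auto simp: gap_def pkey_def
        less_eq_prod_def\<close>)
  then have "successively (\<le>) (map pkey xs)" by (simp add: successively_map)
  then show ?thesis by (simp add: successively_conv_sorted_wrt[OF transp_on_le])
qed

text \<open>Injectivity of \<open>pkey\<close> makes the sorted list of a multiset unique, so the
  quantifier over lists in \<open>cond_i\<close> and \<open>cond_ii\<close> reduces to one
  list.\<close>

lemma all_sorted_lists_iff: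
  assumes "mset xs = X" "sorted (map pkey xs)"
  shows "(\<forall>ys. mset ys = X \<and> sorted (map pkey ys) \<longrightarrow> P ys) \<longleftrightarrow> P xs"
  using assms sorted_pkey_unique by blast

lemma cond_i_iff:
  assumes "mset xs = filter_mset (\<lambda>p. \<not> quaternary (snd p)) M" "sorted (map pkey xs)"
  shows "cond_i M \<longleftrightarrow> successively (gap 1) xs"
proof -
  have "\<not> quaternary (snd (xs ! t))" if "t < length xs" for t
  proof -
    have "xs ! t \<in># mset xs" using that by simp
    then show ?thesis unfolding assms(1) by simp
  qed
  \<comment> \<open>Away from ABCD, the clause \<open>\<not> secondary\<close> of \<open>gap\<close>
    is the clause \<open>primary\<close> of condition (i).\<close>
  then have "\<not> secondary (snd (xs ! t)) \<longleftrightarrow> primary (snd (xs ! t))" if "t < length xs" for t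
    using that by (cases "snd (xs ! t)") (auto simp: secondary_def primary_def quaternary_def)
  then show ?thesis
    unfolding cond_i_def all_sorted_lists_iff[OF assms] successively_conv_nth gap_def
    by (meson Suc_lessD)
qed

lemma cond_ii_iff:
  assumes "mset ys = filter_mset (\<lambda>p. quaternary (snd p)) M" "sorted (map pkey ys)"
  shows "cond_ii M \<longleftrightarrow> successively (gap 4) ys"
proof -
  have "snd (ys ! t) = ABCD" if "t < length ys" for t
  proof -
    have "ys ! t \<in># mset ys" using that by simp
    then show ?thesis unfolding assms(1) by (simp add: quaternary_def)
  qed
  then show ?thesis
    unfolding cond_ii_def all_sorted_lists_iff[OF assms] successively_conv_nth gap_def
    by (auto simp: secondary_def)
qed

lemma obtain_sorted_list:
  obtains xs where "mset xs = X" "sorted (map pkey xs)"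
proof -
  obtain xs where "mset xs = X" using ex_mset by blast
  then show thesis using that[of "sort_key pkey xs"] by simp
qed

lemma mem_chain_lists_quat_1_iff:
  "vs \<in> chain_lists {ABCD} 1 \<longleftrightarrow> vs \<in> chain_lists {ABCD} 0 \<and> (vs = [] \<or> 0 < fst (hd vs))"
proof (cases vs)
  case (Cons v vs')
  have "0 < fst u" if "0 < fst v" "part_le v u" for u
    using that by (auto simp: part_le_def)
  then show ?thesis
    unfolding Cons by (fastforce simp: chain_lists_def)
qed (simp add: chain_lists_def)

lemma chain_lists_Cons_rank:
  assumes "(0, c) # us \<in> chain_lists K 0" "u \<in> set us" "fst u = 0"
  shows "rank c \<le> rank (snd u)"
  using assms by (auto simp: chain_lists_def part_le_def)

lemma mem_start_A_iff:
  "us \<in> start_A \<longleftrightarrow> us \<in> chain_lists nonquat 0 \<and> us \<noteq> [] \<and> hd us = (0, A)"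
proof
  assume "us \<in> start_A"
  then have "us \<in> chain_lists nonquat 4"
    using chain_lists_step(1)[of A nonquat] by (auto simp: start_A_def secondary_def)
  then show "us \<in> chain_lists nonquat 0 \<and> us \<noteq> [] \<and> hd us = (0, A)"
    using \<open>us \<in> start_A\<close> by (auto simp: start_A_def chain_lists_def)
next
  assume us: "us \<in> chain_lists nonquat 0 \<and> us \<noteq> [] \<and> hd us = (0, A)"
  then obtain us' where us': "us = (0, A) # us'" by (metis list.collapse)
  have "us' \<in> chain_lists nonquat 4"
    using us chain_lists_Cons_rank[of A us' nonquat] unfolding us' by (simp add: chain_lists_def)
  then show "us \<in> start_A" unfolding start_A_def us' by blast
qed

lemma mem_start_other_iff:
  "us \<in> start_other \<longleftrightarrow> us \<in> chain_lists nonquat 0 \<and>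
     (us = [] \<or> 0 < fst (hd us) \<or> snd (hd us) \<in> {B, C, D})"
proof
  assume "us \<in> start_other"
  then consider us' where "us = (0, B) # us'" "us' \<in> chain_lists nonquat 7" | "us \<in> chain_lists
      nonquat 9"
    by (auto simp: start_other_def)
  then show "us \<in> chain_lists nonquat 0 \<and> (us = [] \<or> 0 < fst (hd us) \<or> snd (hd us) \<in> {B, C, D})"
  proof cases
    case 1
    then have "us \<in> chain_lists nonquat 7"
      using chain_lists_step(1)[of B nonquat] by (auto simp: secondary_def)
    with 1 show ?thesis by (simp add: chain_lists_def)
  next
    case 2
    have "c \<in> {C, D}" if "9 \<le> rank c" for c using that by (cases c) simp_all
    with 2 show ?thesis by (cases us) (auto simp: chain_lists_def)
  qed
next
  assume us: "us \<in> chain_lists nonquat 0 \<and> (us = [] \<or> 0 < fst (hd us) \<or> snd (hd us) \<in> {B, C, D})"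
  show "us \<in> start_other"
  proof (cases us)
    case Nil
    then show ?thesis by (simp add: start_other_def chain_lists_def)
  next
    case (Cons u us')
    show ?thesis
    proof (cases "fst u = 0")
      case True
      then have u: "u = (0, snd u)" by (simp add: prod_eq_iff)
      have ge: "rank (snd u) \<le> rank (snd v)" if "v \<in> set us'" "fst v = 0" for v
        using chain_lists_Cons_rank[of "snd u" us' nonquat v] us that u unfolding Cons by metis
      consider "snd u = B" | "snd u = C \<or> snd u = D" using us True by (auto simp: Cons)
      then show ?thesis
      proof cases
        case 1
        with us ge have "us' \<in> chain_lists nonquat 7" by (simp add: Cons chain_lists_def)
        with 1 u show ?thesis by (auto simp: start_other_def Cons)
      next
        case 2
        then have "9 \<le> rank (snd u)" by auto
        with us ge have "us \<in> chain_lists nonquat 9"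
          unfolding Cons by (fastforce simp: chain_lists_def)
        then show ?thesis by (simp add: start_other_def)
      qed
    next
      case False
      have "0 < fst v" if "v \<in> set us" for v
        using us that False by (auto simp: Cons chain_lists_def part_le_def)
      with us have "us \<in> chain_lists nonquat 9" by (force simp: chain_lists_def)
      then show ?thesis by (simp add: start_other_def)
    qed
  qed
qed

section \<open>The bijection between configurations and partitions\<close>

definition gpartitions :: "part multiset set" where
  "gpartitions = {M. (\<forall>p\<in>#M. valid_part p) \<and> cond_i M \<and> cond_ii M \<and> cond_iii M}"

definition unshift :: "part list \<times> part list \<Rightarrow> part multiset" where
  "unshift = (\<lambda>(us, vs). mset (stair 1 1 us) + mset (stair (3 + 2 * length us) 4 vs))"

text \<open>Only the head can be too small: after the staircase is added, every later entry is at
  least 2, enough for primary and secondary colors alike.\<close>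

lemma valid_stair_iff:
  assumes "us \<in> chain_lists nonquat 0"
  shows "(\<forall>p\<in>set (stair 1 1 us). valid_part p)
    \<longleftrightarrow> us = [] \<or> 0 < fst (hd us) \<or> \<not> secondary (snd (hd us))"
proof (cases us)
  case (Cons u us')
  have "valid_part p" if "p \<in> set (stair 2 1 us')" for p
  proof -
    have "snd p \<in> snd ` set us'" using that by (metis imageI snd_set_stair)
    moreover have "ABCD \<notin> snd ` set us'" using assms by (auto simp: chain_lists_def Cons)
    ultimately have "snd p \<noteq> ABCD" by metis
    moreover have "2 \<le> fst p" using that by (rule fst_ge_stair')
    ultimately show ?thesis
      by (cases "snd p") (auto simp: valid_part_def minval_def primary_def secondary_def)
  qed
  moreover have "snd u \<noteq> ABCD" using assms by (auto simp: chain_lists_def Cons)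
  then have "valid_part (Suc (fst u), snd u) \<longleftrightarrow> 0 < fst u \<or> \<not> secondary (snd u)"
    by (cases "snd u") (auto simp: valid_part_def minval_def primary_def secondary_def)
  ultimately show ?thesis
    unfolding Cons by (auto simp: numeral_2_eq_2)
qed simp

lemma A1_stair_iff:
  "(1, A) \<in> set (stair 1 1 us) \<longleftrightarrow> us \<noteq> [] \<and> hd us = (0, A)"
proof (cases us)
  case (Cons u us')
  have "(1, A) \<notin> set (stair 2 1 us')" using fst_ge_stair'[of "(1, A)" 2 1 us'] by auto
  then show ?thesis unfolding Cons by (auto simp: numeral_2_eq_2 prod_eq_iff)
qed simp

context
  fixes us vs assumes us: "us \<in> chain_lists nonquat 0" and vs: "vs \<in> chain_lists {ABCD} 0"
begin

lemma filter_unshift: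
  "filter_mset (\<lambda>p. \<not> quaternary (snd p)) (unshift (us, vs)) = mset (stair 1 1 us)"
  "filter_mset (\<lambda>p. quaternary (snd p)) (unshift (us, vs)) = mset (stair (3 + 2 * length us) 4 vs)"
proof -
  have 1: "\<not> quaternary (snd p)" if "p \<in> set (stair 1 1 us)" for p
  proof -
    have "snd p \<in> snd ` set us" using that by (metis imageI snd_set_stair)
    moreover have "snd ` set us \<subseteq> nonquat" using us by (simp add: chain_lists_def)
    ultimately show ?thesis unfolding quaternary_def by blast
  qed
  have 2: "quaternary (snd p)" if "p \<in> set (stair k 4 vs)" for p k
  proof -
    have "snd p \<in> snd ` set vs" using that by (metis imageI snd_set_stair)
    moreover have "snd ` set vs \<subseteq> {ABCD}" using vs by (simp add: chain_lists_def)
    ultimately show ?thesis unfolding quaternary_def by blast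
  qed
  have "filter (\<lambda>p. \<not> quaternary (snd p)) (stair 1 1 us) = stair 1 1 us"
      "filter (\<lambda>p. \<not> quaternary (snd p)) (stair (3 + 2 * length us) 4 vs) = []"
      "filter (\<lambda>p. quaternary (snd p)) (stair 1 1 us) = []"
      "filter (\<lambda>p. quaternary (snd p)) (stair (3 + 2 * length us) 4 vs)
          = stair (3 + 2 * length us) 4 vs"
      unfolding filter_id_conv filter_empty_conv using 1 2 by blast+
    then show "filter_mset (\<lambda>p. \<not> quaternary (snd p)) (unshift (us, vs)) = mset (stair 1 1 us)"
      "filter_mset (\<lambda>p. quaternary (snd p)) (unshift (us, vs))
          = mset (stair (3 + 2 * length us) 4 vs)"
      by (simp_all only: unshift_def prod.case filter_union_mset mset_filter[symmetric] mset.simps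
          add_0_left add_0_right)
qed

lemma gap_unshift: "successively (gap 1) (stair 1 1 us)" "successively (gap 4) (stair k 4 vs)"
  using us vs sorted_wrt_part_le_iff by (auto simp: chain_lists_def)

lemma A1_unshift_iff: "(1, A) \<in># unshift (us, vs) \<longleftrightarrow> us \<noteq> [] \<and> hd us = (0, A)"
proof -
  have "(1, A) \<in># unshift (us, vs) \<longleftrightarrow> (1, A) \<in># filter_mset (\<lambda>p. \<not> quaternary (snd p))
      (unshift (us, vs))"
    by (simp add: quaternary_def)
  then show ?thesis by (simp only: filter_unshift set_mset_mset A1_stair_iff)
qed

text \<open>The staircases build in (i) and (ii). For (iii) the first quaternary entry decides; the
  offset 3 + 2\<tau> already meets the bound in the presence of A_1, and one more is required
  otherwise.\<close>

lemma unshift_conditions: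
  "cond_i (unshift (us, vs))" "cond_ii (unshift (us, vs))"
  "cond_iii (unshift (us, vs)) \<longleftrightarrow> vs = [] \<or> (us \<noteq> [] \<and> hd us = (0, A)) \<or> 0 < fst (hd vs)"
proof -
  show "cond_i (unshift (us, vs))"
    using cond_i_iff[OF filter_unshift(1)[symmetric]] gap_unshift(1)
        sorted_pkey_gap[OF gap_unshift(1)] by simp
  show "cond_ii (unshift (us, vs))"
    using cond_ii_iff[OF filter_unshift(2)[symmetric]] gap_unshift(2)
        sorted_pkey_gap[OF gap_unshift(2)] by simp
  let ?ys = "stair (3 + 2 * length us) 4 vs"
  define a :: nat where "a = (if us \<noteq> [] \<and> hd us = (0, A) then 3 else 4)"
  have "cond_iii (unshift (us, vs)) \<longleftrightarrow>
      (\<forall>q\<in># filter_mset (\<lambda>p. quaternary (snd p)) (unshift (us, vs)). a + 2 * length us \<le> fst q)"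
    unfolding cond_iii_def Let_def filter_unshift(1) A1_unshift_iff a_def set_mset_filter
      size_mset length_stair by blast
  also have "\<dots> \<longleftrightarrow> (\<forall>q\<in>set ?ys. a + 2 * length us \<le> fst q)"
    by (simp only: filter_unshift set_mset_mset)
  also have "\<dots> \<longleftrightarrow> vs = [] \<or> a \<le> 3 + fst (hd vs)"
  proof
    assume *: "\<forall>q\<in>set ?ys. a + 2 * length us \<le> fst q"
    show "vs = [] \<or> a \<le> 3 + fst (hd vs)"
    proof (cases "vs = []")
      case False
      then have "hd ?ys \<in> set ?ys" by (intro hd_in_set) simp
      with * have "a + 2 * length us \<le> fst (hd ?ys)" by blast
      then show ?thesis using hd_stair[OF False] by simp
    qed simp
  next
    assume *: "vs = [] \<or> a \<le> 3 + fst (hd vs)"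
    show "\<forall>q\<in>set ?ys. a + 2 * length us \<le> fst q"
    proof
      fix q assume q: "q \<in> set ?ys"
      then have "fst (hd vs) + (3 + 2 * length us) \<le> fst q"
        using vs by (intro fst_ge_stair) (auto simp: chain_lists_def)
      moreover have "vs \<noteq> []" using q by auto
      ultimately show "a + 2 * length us \<le> fst q" using * by simp
    qed
  qed
  finally show "cond_iii (unshift (us, vs)) \<longleftrightarrow> vs
      = [] \<or> (us \<noteq> [] \<and> hd us = (0, A)) \<or> 0 < fst (hd vs)"
    by (auto simp: a_def)
qed

lemma valid_unshift_iff:
  assumes "cond_iii (unshift (us, vs))"
  shows "(\<forall>p\<in>#unshift (us, vs). valid_part p) \<longleftrightarrow> us
      = [] \<or> 0 < fst (hd us) \<or> \<not> secondary (snd (hd us))"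
proof -
  have "valid_part p" if "p \<in># unshift (us, vs)" "quaternary (snd p)" for p
  proof -
    have "(if us \<noteq> [] \<and> hd us = (0, A) then 3 else 4) + 2 * length us \<le> fst p"
      using assms that unfolding cond_iii_def Let_def filter_unshift(1) A1_unshift_iff by simp
    \<comment> \<open>The bound with 3 occurs only for nonempty \<open>us\<close>, where 2\<tau>
      adds at least 2, so the minimum 4 of the quaternary color is met in both cases.\<close>
    then have "4 \<le> fst p" by (cases us) (auto split: if_splits)
    with that show ?thesis by (simp add: valid_part_def minval_def quaternary_def primary_def
        secondary_def)
  qed
  then have "(\<forall>p\<in>#unshift (us, vs). valid_part p) \<longleftrightarrow>
      (\<forall>p\<in># filter_mset (\<lambda>p. \<not> quaternary (snd p)) (unshift (us, vs)). valid_part p)"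
    unfolding set_mset_filter by blast
  also have "\<dots> \<longleftrightarrow> (\<forall>p\<in>set (stair 1 1 us). valid_part p)"
    by (simp only: filter_unshift set_mset_mset)
  finally show ?thesis using valid_stair_iff[OF us] by simp
qed

lemma unshift_mem_iff: "unshift (us, vs) \<in> gpartitions \<longleftrightarrow> (us, vs) \<in> configs"
proof -
  have start: "us \<in> start_A \<or> us \<in> start_other \<longleftrightarrow> us
      = [] \<or> 0 < fst (hd us) \<or> \<not> secondary (snd (hd us))"
  proof (cases us)
    case (Cons u us')
    then have "snd u \<noteq> ABCD" using us by (auto simp: chain_lists_def)
    then have "\<not> secondary (snd u) \<longleftrightarrow> snd u \<in> {A, B, C, D}"
      by (cases "snd u") (simp_all add: secondary_def)
    with us show ?thesis
      unfolding mem_start_A_iff mem_start_other_iff by (auto simp: Cons prod_eq_iff)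
  qed (use us in \<open>simp add: mem_start_other_iff\<close>)
  have A: "us \<in> start_A \<longleftrightarrow> us \<noteq> [] \<and> hd us = (0, A)"
    using us by (simp add: mem_start_A_iff)
  have "unshift (us, vs) \<in> gpartitions \<longleftrightarrow>
      (\<forall>p\<in>#unshift (us, vs). valid_part p) \<and> cond_iii (unshift (us, vs))"
    using unshift_conditions(1,2) by (simp add: gpartitions_def)
  also have "\<dots> \<longleftrightarrow> (us \<in> start_A \<or> us \<in> start_other) \<and> cond_iii (unshift (us, vs))"
    using valid_unshift_iff start by blast
  also have "\<dots> \<longleftrightarrow> (us \<in> start_A \<or> us \<in> start_other) \<and> (vs = [] \<or> us \<in> start_A \<or> 0 < fst (hd vs))"
    by (simp only: unshift_conditions(3) A)
  also have "\<dots> \<longleftrightarrow> (us, vs) \<in> configs"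
    unfolding configs_def mem_Times_iff Un_iff mem_chain_lists_quat_1_iff fst_conv snd_conv
    using vs by auto
  finally show ?thesis .
qed

end

lemma configs_chain_lists:
  "(us, vs) \<in> configs \<Longrightarrow> us \<in> chain_lists nonquat 0 \<and> vs \<in> chain_lists {ABCD} 0"
  unfolding configs_def using mem_start_A_iff mem_start_other_iff mem_chain_lists_quat_1_iff
      by blast

lemma unshift_inject:
  assumes "(us, vs) \<in> configs" "(us', vs') \<in> configs" "unshift (us, vs) = unshift (us', vs')"
  shows "us = us' \<and> vs = vs'"
proof -
  have us: "us \<in> chain_lists nonquat 0" "us' \<in> chain_lists nonquat 0"
    and vs: "vs \<in> chain_lists {ABCD} 0" "vs' \<in> chain_lists {ABCD} 0"
    using assms configs_chain_lists by blast+
  have "mset (stair 1 1 us) = mset (stair 1 1 us')"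
    using filter_unshift(1)[OF us(1) vs(1)] filter_unshift(1)[OF us(2) vs(2)] assms(3) by simp
  then have "stair 1 1 us = stair 1 1 us'"
    using sorted_pkey_gap[OF gap_unshift(1)[OF us(1) vs(1)]]
        sorted_pkey_gap[OF gap_unshift(1)[OF us(2) vs(2)]]
    by (intro sorted_pkey_unique) simp_all
  then have eq: "us = us'" by simp
  let ?k = "3 + 2 * length us"
  have "mset (stair ?k 4 vs) = mset (stair ?k 4 vs')"
    using filter_unshift(2)[OF us(1) vs(1)] filter_unshift(2)[OF us(2) vs(2)] assms(3) eq by simp
  then have "stair ?k 4 vs = stair ?k 4 vs'"
    using sorted_pkey_gap[OF gap_unshift(2)[OF us(1) vs(1)]]
        sorted_pkey_gap[OF gap_unshift(2)[OF us(2) vs(2)]]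
    by (intro sorted_pkey_unique) simp_all
  with eq show ?thesis by simp
qed

text \<open>Both kinds of parts are sorted and lowered by \<open>stair_surj\<close>. Its lower bound
  on the head comes from validity for the non-quaternary parts, and from the weaker form of (iii)
  for the quaternary ones.\<close>

lemma gpartitions_subset: "gpartitions \<subseteq> unshift ` configs"
proof
  fix M assume M: "M \<in> gpartitions"
  obtain xs where xs: "mset xs = filter_mset (\<lambda>p. \<not> quaternary (snd p)) M" "sorted (map pkey xs)"
    by (rule obtain_sorted_list)
  obtain ys where ys: "mset ys = filter_mset (\<lambda>p. quaternary (snd p)) M" "sorted (map pkey ys)"
    by (rule obtain_sorted_list)
  have "cond_iii M" using M by (simp add: gpartitions_def)
  have gap: "successively (gap 1) xs" "successively (gap 4) ys"
    using M cond_i_iff[OF xs] cond_ii_iff[OF ys] by (simp_all add: gpartitions_def)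
  have memx: "p \<in># M \<and> \<not> quaternary (snd p)" if "p \<in> set xs" for p
  proof -
    from that have "p \<in># mset xs" by simp
    then show ?thesis unfolding xs(1) by simp
  qed
  have memy: "p \<in># M \<and> quaternary (snd p)" if "p \<in> set ys" for p
  proof -
    from that have "p \<in># mset ys" by simp
    then show ?thesis unfolding ys(1) by simp
  qed
  have "1 \<le> fst (hd xs)" if "xs \<noteq> []"
  proof -
    have "valid_part (hd xs)" using memx[OF hd_in_set[OF that]] M by (simp add: gpartitions_def)
    then show ?thesis by (auto simp: valid_part_def minval_def split: if_splits)
  qed
  with gap(1) obtain us where us: "xs = stair 1 1 us" by (rule stair_surj)
  have len: "size (filter_mset (\<lambda>p. \<not> quaternary (snd p)) M) = length us"
    by (metis us length_stair size_mset xs(1))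
  have "3 + 2 * length us \<le> fst (hd ys)" if "ys \<noteq> []"
  proof -
    have "(if (1, A) \<in># M then 3 else 4) + 2 * length us \<le> fst (hd ys)"
      using memy[OF hd_in_set[OF that]] \<open>cond_iii M\<close> unfolding cond_iii_def Let_def len by blast
    then show ?thesis by (simp split: if_splits)
  qed
  with gap(2) obtain vs where vs: "ys = stair (3 + 2 * length us) 4 vs" by (rule stair_surj)
  have M_eq: "M = unshift (us, vs)"
    using multiset_partition[of M "\<lambda>p. quaternary (snd p)"] xs(1) ys(1) us vs
    by (simp add: unshift_def add.commute)
  have "us \<in> chain_lists nonquat 0"
  proof -
    have "ABCD \<notin> snd ` set xs" using memx unfolding quaternary_def by (metis imageE)
    then show ?thesis
      using gap(1) unfolding us snd_set_stair sorted_wrt_part_le_iff[symmetric]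
          by (auto simp: chain_lists_def)
  qed
  moreover have "vs \<in> chain_lists {ABCD} 0"
  proof -
    have "snd ` set ys \<subseteq> {ABCD}" using memy unfolding quaternary_def by blast
    then show ?thesis
      using gap(2) unfolding vs snd_set_stair sorted_wrt_part_le_iff[symmetric]
          by (auto simp: chain_lists_def)
  qed
  ultimately have "(us, vs) \<in> configs"
    using M unfolding M_eq by (simp only: unshift_mem_iff)
  then show "M \<in> unshift ` configs" unfolding M_eq by blast
qed

lemma bij_betw_unshift: "bij_betw unshift configs gpartitions"
  unfolding bij_betw_def
proof
  show "inj_on unshift configs"
    using unshift_inject by (intro inj_onI) auto
  show "unshift ` configs = gpartitions"
  proof (rule equalityI[OF _ gpartitions_subset], rule image_subsetI)
    fix x assume x: "x \<in> configs"
    obtain us vs where "x = (us, vs)" by (cases x)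
    with x show "unshift x \<in> gpartitions"
      using unshift_mem_iff configs_chain_lists[of us vs] by simp
  qed
qed

text \<open>The n terms (3 + 2m) + (7 + 2m) + ... add up to the increase of the triangular number
  from index m to m + 2n; this is why quaternary entries count twice in the degree.\<close>

lemma sum_unshift:
  "sum_mset (image_mset fst (unshift x)) = config_value x + (Suc (config_degree x) choose 2)"
proof -
  obtain us vs where x: "x = (us, vs)" by (cases x)
  have "m + 2 * n + (m + 2 * n choose 2) = m + (m choose 2) + (3 + 2 * m) * n
      + 4 * (n choose 2)" for m n :: nat
    by (induction n) (simp_all add: Suc_choose_2 binomial_eq_0)
  from this[of "length us" "length vs"] have
    "sum_list (map fst (stair 1 1 us)) + sum_list (map fst (stair (3 + 2 * length us) 4 vs))
      = config_value x + (Suc (config_degree x) choose 2)"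
    unfolding total_value_def[symmetric] total_value_stair x Suc_choose_2 by simp
  then show ?thesis
    by (simp add: unshift_def x sum_mset_sum_list flip: mset_map)
qed

lemma config_weight_unshift:
  "config_weight W x = prod_mset (image_mset (\<lambda>p. W (snd p)) (unshift x))"
proof -
  obtain us vs where x: "x = (us, vs)" by (cases x)
  have "weight W us = weight W (stair 1 1 us)" "weight W vs
      = weight W (stair (3 + 2 * length us) 4 vs)"
    by (simp_all only: weight_stair)
  then show ?thesis
    by (simp only: x unshift_def prod.case weight_def image_mset_union prod_mset.union
        prod_mset_prod_list mset_map[symmetric])
qed

section \<open>Counting by color content\<close>

definition content :: "color \<Rightarrow> nat \<times> nat \<times> nat \<times> nat" where
  "content c = (of_bool (c \<in> {A, AB, AC, AD, ABCD}), of_bool (c \<in> {B, AB, BC, BD, ABCD}),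
     of_bool (c \<in> {C, AC, BC, CD, ABCD}), of_bool (c \<in> {D, AD, BD, CD, ABCD}))"

text \<open>Poly mappings on quadruples of exponents model integer polynomials in a, b, c, d; each
  color becomes the monomial of its primary constituents.\<close>

definition monom_weight :: "color \<Rightarrow> (nat \<times> nat \<times> nat \<times> nat) \<Rightarrow>\<^sub>0 int" where
  "monom_weight c = Poly_Mapping.single (content c) 1"

definition contents :: "part multiset \<Rightarrow> nat \<times> nat \<times> nat \<times> nat" where
  "contents M = sum_mset (image_mset (\<lambda>p. content (snd p)) M)"

lemma primary_weights_monom_weight: "primary_weights monom_weight"
  by unfold_locales (simp_all add: monom_weight_def content_def mult_single)

lemma prod_monom_weight:
  "prod_mset (image_mset (\<lambda>p. monom_weight (snd p)) M) = Poly_Mapping.single (contents M) 1"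
  by (induction M) (simp_all add: contents_def monom_weight_def mult_single)

abbreviation color_count :: "part multiset \<Rightarrow> color \<Rightarrow> nat" where
  "color_count M c \<equiv> size (filter_mset (\<lambda>p. snd p = c) M)"

lemma contents_eq:
  "contents M =
    (color_count M A + color_count M AB + color_count M AC + color_count M AD + color_count M ABCD,
     color_count M B + color_count M AB + color_count M BC + color_count M BD + color_count M ABCD,
     color_count M C + color_count M AC + color_count M BC + color_count M CD + color_count M ABCD,
     color_count M D + color_count M AD + color_count M BD + color_count M CD + color_count M ABCD)"
proof (induction M)
  case (add p M)
  have "contents (add_mset p M) = content (snd p) + contents M"
    by (simp add: contents_def)
  then show ?case unfolding add.IH by (cases "snd p") (simp_all add: content_def)
qed (simp add: contents_def zero_prod_def)

lemma lookup_sum_single: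
  assumes "finite X"
  shows "Poly_Mapping.lookup (\<Sum>x\<in>X. Poly_Mapping.single (f x) (1 :: int)) v
      = int (card {x\<in>X. f x = v})"
  using assms by (simp add: lookup_sum lookup_single when_def sum.If_cases Int_def eq_commute[of v])

lemma finite_gpartitions: "finite {M\<in>gpartitions. sum_mset (image_mset fst M) = n}"
  and sum_gpartitions:
    "(\<Sum>M\<in>{M\<in>gpartitions. sum_mset (image_mset fst M) = n}. prod_mset (image_mset (\<lambda>p. W (snd p)) M))
      = stair_sum (gf configs config_degree config_value (config_weight W)) $ n"
proof -
  let ?X = "{x\<in>configs. config_value x + (Suc (config_degree x) choose 2) = n}"
  let ?Y = "{M\<in>gpartitions. sum_mset (image_mset fst M) = n}"
  have bij: "bij_betw unshift ?X ?Y"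
    by (rule bij_betw_Collect[OF bij_betw_unshift]) (simp only: sum_unshift)
  have "finite ?X"
    using graded_configs by (rule finite_stair_sum_fiber)
  then show "finite ?Y" using bij bij_betw_finite by blast
  have "stair_sum (gf configs config_degree config_value (config_weight W)) $ n
      = (\<Sum>x\<in>?X. config_weight W x)"
    by (rule stair_sum_gf_nth[OF graded_configs])
  also have "\<dots> = (\<Sum>x\<in>?X. prod_mset (image_mset (\<lambda>p. W (snd p)) (unshift x)))"
    by (simp only: config_weight_unshift)
  also have "\<dots> = (\<Sum>M\<in>?Y. prod_mset (image_mset (\<lambda>p. W (snd p)) M))"
    by (rule sum.reindex_bij_betw[OF bij])
  finally show "(\<Sum>M\<in>?Y. prod_mset (image_mset (\<lambda>p. W (snd p)) M))
      = stair_sum (gf configs config_degree config_value (config_weight W)) $ n" by simp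
qed

text \<open>A partition determines its color counts, so the sets counted for different
  \<open>c\<close> are disjoint; by \<open>contents_eq\<close> the range of summation prescribes the
  contents of their union.\<close>

lemma sum_G_count:
  "(\<Sum>c \<in> {c. i = c A + c AB + c AC + c AD + c ABCD
            \<and> j = c B + c AB + c BC + c BD + c ABCD
            \<and> k = c C + c AC + c BC + c CD + c ABCD
            \<and> l = c D + c AD + c BD + c CD + c ABCD}. G_count n c)
    = card {M\<in>gpartitions. sum_mset (image_mset fst M) = n \<and> contents M = (i, j, k, l)}"
  (is "sum _ ?K = card ?Y")
proof -
  define F where "F c = {M\<in>gpartitions. sum_mset (image_mset fst M) = n \<and> color_count M = c}" for c
  have "G_count n c = card (F c)" for c
    unfolding G_count_def F_def gpartitions_def
    by (rule arg_cong[of _ _ card]) (auto simp: fun_eq_iff)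
  then have "sum (G_count n) ?K = (\<Sum>c\<in>?K. card (F c))" by simp
  also have "\<dots> = card (\<Union>c\<in>?K. F c)"
  proof (rule card_UN_disjoint[symmetric])
    \<comment> \<open>Each color occurs in at least one of the four equations, which bounds its
      count and makes the range of summation finite.\<close>
    have "c x \<le> i + j + k + l" if "c \<in> ?K" for c x
      using that by (cases x) auto
    then have "?K \<subseteq> {c. \<forall>x. (x \<in> UNIV \<longrightarrow> c x \<in> {..i + j + k + l}) \<and> (x \<notin> UNIV \<longrightarrow> c x = 0)}"
      by auto
    moreover have "finite {c :: color \<Rightarrow> nat. \<forall>x. (x \<in> UNIV \<longrightarrow> c x \<in> {..i + j + k + l})
        \<and> (x \<notin> UNIV \<longrightarrow> c x = 0)}"
      by (rule finite_set_of_finite_funs) simp_all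
    ultimately show "finite ?K" by (rule finite_subset)
    show "\<forall>c\<in>?K. finite (F c)"
      by (auto simp: F_def intro: finite_subset[OF _ finite_gpartitions[of n]])
    show "\<forall>c\<in>?K. \<forall>c'\<in>?K. c \<noteq> c' \<longrightarrow> F c \<inter> F c' = {}"
      by (auto simp: F_def)
  qed
  also have "(\<Union>c\<in>?K. F c) = ?Y"
    unfolding F_def contents_eq by auto
  finally show ?thesis .
qed

section \<open>The product side and partitions into distinct primary parts\<close>

lemma dvd_cong_X_power_nth:
  assumes "dvd_cong (fps_X ^ k) f g" "n < k"
  shows "f $ n = g $ n"
proof -
  obtain h where "f - g = fps_X ^ k * h"
    using assms(1) unfolding dvd_cong_def by (rule dvdE)
  then have "(f - g) $ n = 0" using assms(2) by (simp add: fps_X_power_mult_nth)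
  then show ?thesis by simp
qed

lemma prod_one_plus_nth:
  fixes w :: "'a \<Rightarrow> 'p::comm_ring_1" and s :: "'a \<Rightarrow> nat"
  assumes "finite X"
  shows "(\<Prod>x\<in>X. 1 + fps_const (w x) * fps_X ^ s x) $ n = (\<Sum>Y\<in>{Y. Y \<subseteq> X \<and> sum s Y = n}. prod w Y)"
proof -
  have fin: "finite Y" if "Y \<subseteq> X" for Y using assms that by (rule rev_finite_subset)
  have "(\<Prod>x\<in>X. 1 + fps_const (w x) * fps_X ^ s x) = (\<Sum>Y\<in>Pow X. \<Prod>x\<in>Y. fps_const (w x) * fps_X ^ s x)"
    using prod_add[OF assms, of "\<lambda>x. fps_const (w x) * fps_X ^ s x" "\<lambda>_. 1"]
        by (simp add: add.commute)
  also have "\<dots> = (\<Sum>Y\<in>Pow X. fps_const (prod w Y) * fps_X ^ sum s Y)"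
  proof (rule sum.cong[OF refl])
    fix Y assume "Y \<in> Pow X"
    then have "finite Y" using fin by blast
    then show "(\<Prod>x\<in>Y. fps_const (w x) * fps_X ^ s x) = fps_const (prod w Y) * fps_X ^ sum s Y"
      by (induction Y rule: finite_induct) (simp_all add: power_add mult_ac flip: fps_const_mult)
  qed
  finally have "(\<Prod>x\<in>X. 1 + fps_const (w x) * fps_X ^ s x) $ n
      = (\<Sum>Y\<in>Pow X. if sum s Y = n then prod w Y else 0)"
    by (simp add: fps_sum_nth fps_X_power_mult_right_nth) (rule sum.cong; auto)
  also have "\<dots> = (\<Sum>Y\<in>{Y\<in>Pow X. sum s Y = n}. prod w Y)"
    using assms by (intro sum.inter_filter[symmetric]) simp
  finally show ?thesis by (simp only: Pow_iff)
qed

definition parts_upto :: "nat \<Rightarrow> part set" where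
  "parts_upto k = {1..k} \<times> {A, B, C, D}"

text \<open>With multiplicities at most 1 a multiset is a finite set, and no part exceeds the sum n,
  so cutting off at any \<open>h\<close> from n on loses nothing.\<close>

lemma P_count_eq:
  assumes "n \<le> h"
  shows "P_count n i j k l =
    card {Y. Y \<subseteq> parts_upto h \<and> sum fst Y = n \<and> contents (mset_set Y) = (i, j, k, l)}"
proof -
  let ?P = "{M :: part multiset.
      (\<forall>p \<in># M. primary (snd p) \<and> valid_part p)
    \<and> (\<forall>p. count M p \<le> 1)
    \<and> sum_mset (image_mset fst M) = n
    \<and> color_count M A = i \<and> color_count M B = j \<and> color_count M C = k \<and> color_count M D = l}"
  let ?Y = "{Y. Y \<subseteq> parts_upto h \<and> sum fst Y = n \<and> contents (mset_set Y) = (i, j, k, l)}"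
  have contents: "contents M = (color_count M A, color_count M B, color_count M C, color_count M D)"
    if "\<forall>p\<in>#M. primary (snd p)" for M
  proof -
    have "color_count M c = 0" if "\<not> primary c" for c
      using \<open>\<forall>p\<in>#M. primary (snd p)\<close> that by auto
    then show ?thesis by (simp add: contents_eq primary_def)
  qed
  have part: "p \<in> parts_upto h \<longleftrightarrow> primary (snd p) \<and> valid_part p \<and> fst p \<le> h" for p
    by (cases p) (auto simp: parts_upto_def primary_def valid_part_def minval_def)
  have fin: "finite (parts_upto h)" by (simp add: parts_upto_def)
  have mset_set: "mset_set (set_mset M) = M" if "M \<in> ?P" for M
  proof (rule multiset_eqI)
    fix p
    have "count M p \<le> 1" using that by blast
    moreover have "0 < count M p \<longleftrightarrow> p \<in># M" by simp
    ultimately show "count (mset_set (set_mset M)) p = count M p"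
      unfolding count_mset_set' by (cases "count M p") simp_all
  qed
  have "bij_betw mset_set ?Y ?P"
  proof (rule bij_betwI[where g = set_mset])
    show "mset_set \<in> ?Y \<rightarrow> ?P"
    proof
      fix Y assume Y: "Y \<in> ?Y"
      then have finY: "finite Y" using fin finite_subset by blast
      have "\<forall>p\<in>#mset_set Y. primary (snd p) \<and> valid_part p"
        using Y part finY by auto
      moreover have "sum_mset (image_mset fst (mset_set Y)) = n"
        using Y by (simp add: sum_unfold_sum_mset)
      moreover have "count (mset_set Y) p \<le> 1" for p
        using finY by (simp add: count_mset_set')
      ultimately show "mset_set Y \<in> ?P"
        using Y contents[of "mset_set Y"] by auto
    qed
    show "set_mset \<in> ?P \<rightarrow> ?Y"
    proof
      fix M assume M: "M \<in> ?P"
      then have M_eq: "mset_set (set_mset M) = M" by (rule mset_set)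
      have "fst p \<le> n" if "p \<in># M" for p
      proof -
        from multi_member_split[OF that] obtain M' where "M = add_mset p M'" by blast
        then show ?thesis using M by auto
      qed
      then have "set_mset M \<subseteq> parts_upto h"
        using M part assms by force
      moreover have "sum fst (set_mset M) = n"
        using M M_eq by (simp add: sum_unfold_sum_mset)
      ultimately show "set_mset M \<in> ?Y"
        using M contents[of M] M_eq by auto
    qed
    show "set_mset (mset_set Y) = Y" if "Y \<in> ?Y" for Y
      using that finite_subset[OF _ fin, of Y] by simp
    show "mset_set (set_mset M) = M" if "M \<in> ?P" for M
      using that by (rule mset_set)
  qed
  then show ?thesis
    unfolding P_count_def by (simp add: bij_betw_same_card)
qed

theorem theorem2:
  fixes n i j k l :: nat
  shows "P_count n i j k l =
    (\<Sum>c \<in> {c :: color \<Rightarrow> nat.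
              i = c A + c AB + c AC + c AD + c ABCD
            \<and> j = c B + c AB + c BC + c BD + c ABCD
            \<and> k = c C + c AC + c BC + c CD + c ABCD
            \<and> l = c D + c AD + c BD + c CD + c ABCD}. G_count n c)"
proof -
  interpret primary_weights monom_weight by (rule primary_weights_monom_weight)
  let ?W = "\<lambda>c. fps_const (monom_weight c)"
  let ?Y = "{M\<in>gpartitions. sum_mset (image_mset fst M) = n}"
  \<comment> \<open>The cutoff n + 1 matches the congruence modulo q^(n + 1), which fixes the
    coefficient of q^n.\<close>
  let ?Z = "{Y. Y \<subseteq> parts_upto (Suc n) \<and> sum fst Y = n}"
  have finZ: "finite ?Z"
    by (rule finite_subset[of _ "Pow (parts_upto (Suc n))"]) (auto simp: parts_upto_def)
  have "(\<Sum>M\<in>?Y. Poly_Mapping.single (contents M) (1::int))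
      = stair_sum (config_series (?W A) (?W B) (?W C) (?W D)) $ n"
    using sum_gpartitions[of monom_weight n] unfolding prod_monom_weight gf_configs .
  also have "\<dots> = (\<Prod>m=1..Suc n. (1 + ?W A * fps_X ^ m) * (1 + ?W B * fps_X ^ m)
      * (1 + ?W C * fps_X ^ m) * (1 + ?W D * fps_X ^ m)) $ n"
    by (rule dvd_cong_X_power_nth[OF stair_sum_config_series_cong_prod]) simp
  also have "(\<Prod>m=1..Suc n. (1 + ?W A * fps_X ^ m) * (1 + ?W B * fps_X ^ m)
      * (1 + ?W C * fps_X ^ m) * (1 + ?W D * fps_X ^ m))
      = (\<Prod>p\<in>parts_upto (Suc n). 1 + fps_const (monom_weight (snd p)) * fps_X ^ fst p)"
    unfolding parts_upto_def prod.cartesian_product' by (rule prod.cong) (simp_all add: mult.assoc)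
  also have "\<dots> $ n = (\<Sum>Y\<in>?Z. \<Prod>p\<in>Y. monom_weight (snd p))"
    by (rule prod_one_plus_nth) (simp add: parts_upto_def)
  also have "\<dots> = (\<Sum>Y\<in>?Z. Poly_Mapping.single (contents (mset_set Y)) 1)"
    unfolding prod_monom_weight[symmetric] by (simp add: prod_unfold_prod_mset)
  \<comment> \<open>Comparing the coefficients of a^i b^j c^k d^l turns the equality of polynomials
    into one of cardinalities.\<close>
  finally have "Poly_Mapping.lookup (\<Sum>M\<in>?Y. Poly_Mapping.single (contents M) (1::int)) (i, j, k, l)
      = Poly_Mapping.lookup (\<Sum>Y\<in>?Z. Poly_Mapping.single (contents (mset_set Y)) (1::int))
          (i, j, k, l)"
    by simp
  then have "card {M\<in>?Y. contents M = (i, j, k, l)}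
      = card {Y\<in>?Z. contents (mset_set Y) = (i, j, k, l)}"
    unfolding lookup_sum_single[OF finite_gpartitions] lookup_sum_single[OF finZ] by simp
  then show ?thesis
    unfolding sum_G_count P_count_eq[of n "Suc n", simplified] by (simp add: conj_assoc)
qed

end
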